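(* Let $I$ be the pullback shape category $\{\bullet\to\bullet\leftarrow\bullet\}$. Let $\mathcal{A}$ be the $2$-category generated by objects $X,L,A,B,C$; morphisms $f,g\colon X\to L$, $\lambda_0\colon L\to B$, $\lambda_1\colon L\to C$, $b\colon B\to A$, $c\colon C\to A$; and a $2$-morphism $\alpha\colon f\Rightarrow g$; subject to the relation $b\lambda_0=c\lambda_1$. Let $F\colon I\to\mathcal{A}$ be the diagram $B\xrightarrow{b}A\xleftarrow{c}C$, and let $\lambda\colon\Delta L\Rightarrow F$ be the $2$-cone with components $\lambda_0$ at $B$, $\lambda_1$ at $C$ and $b\lambda_0=c\lambda_1$ at $A$. Then $(L,\lambda)$ is the $2$-limit of $F$, but it is not $2$-terminal in the lax-slice $\Delta\downarrow_l F$ of $2$-cones over $F$.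
   Context: $2$-categories and $2$-functors are strict; $*$ denotes horizontal composition (and whiskering) of $2$-morphisms and juxtaposition denotes vertical composition. "Generated by the data subject to relations" means the $2$-category freely generated by the listed objects, morphisms and $2$-morphisms, modulo the listed relations. The $1$-category $I$ is regarded as a $2$-category with only identity $2$-morphisms. A $2$-natural transformation $\mu\colon F\Rightarrow G$ between $2$-functors $F,G\colon I\to\mathcal{A}$ consists of morphisms $\mu_i\colon Fi\to Gi$ with $(Gf)\mu_i=\mu_j(Ff)$ for every $f\colon i\to j$ in $I$ and $G\alpha*\mu_i=\mu_j*F\alpha$ for every $2$-morphism $\alpha$ in $I$. A modification $\varphi\colon\mu\to\nu$ consists of $2$-morphisms $\varphi_i\colon\mu_i\Rightarrow\nu_i$ with $Gf*\varphi_i=\varphi_j*Ff$ for every $f\colon i\to j$. $[I,\mathcal{A}]$ is the $2$-category of $2$-functors, $2$-natural transformations and modifications; $\Delta X$ is the constant $2$-functor at $X$; a $2$-cone over $F$ is a $2$-natural transformation $\Delta X\Rightarrow F$. A $2$-limit of $F$ is a pair $(L,\lambda\colon\Delta L\Rightarrow F)$ with $\lambda$ a $2$-cone such that for each $X\in\mathcal{A}$ the functor $\lambda_*\circ\Delta\colon\mathcal{A}(X,L)\to[I,\mathcal{A}](\Delta X,F)$, given by post-composition with $\lambda$, is an isomorphism of categories. The lax-slice $\Delta\downarrow_l F$ of $2$-cones is the $2$-category whose objects are pairs $(X,\mu)$ with $\mu\colon\Delta X\Rightarrow F$ a $2$-cone; morphisms $(X,\mu)\to(Y,\nu)$ are pairs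 $(f,\varphi)$ of a morphism $f\colon X\to Y$ in $\mathcal{A}$ and a modification $\varphi\colon\nu\Delta f\to\mu$; $2$-morphisms $(f,\varphi)\Rightarrow(g,\psi)$ are $2$-morphisms $\alpha\colon f\Rightarrow g$ in $\mathcal{A}$ with $\psi(\nu*\Delta\alpha)=\varphi$. An object $L$ of a $2$-category $\mathcal{B}$ is $2$-terminal if for all $X\in\mathcal{B}$ the category $\mathcal{B}(X,L)$ is isomorphic to the terminal category $\mathbb{1}$. *)

theory Defs
  imports Main "HOL-Library.FuncSet"
begin

section \<open>Categories\<close>

record ('o, 'm) cat =
  Ob  :: "'o set"
  Ar  :: "'m set"
  Dom :: "'m \<Rightarrow> 'o"
  Cod :: "'m \<Rightarrow> 'o"
  Idn :: "'o \<Rightarrow> 'm"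
  Cmp :: "'m \<Rightarrow> 'm \<Rightarrow> 'm"

locale category =
  fixes C :: "('o, 'm) cat"
  assumes Dom_Ob: "f \<in> Ar C \<Longrightarrow> Dom C f \<in> Ob C"
    and Cod_Ob: "f \<in> Ar C \<Longrightarrow> Cod C f \<in> Ob C"
    and Idn_Ar: "x \<in> Ob C \<Longrightarrow> Idn C x \<in> Ar C"
    and Dom_Idn: "x \<in> Ob C \<Longrightarrow> Dom C (Idn C x) = x"
    and Cod_Idn: "x \<in> Ob C \<Longrightarrow> Cod C (Idn C x) = x"
    and Cmp_Ar: "\<lbrakk>f \<in> Ar C; g \<in> Ar C; Dom C g = Cod C f\<rbrakk> \<Longrightarrow> Cmp C g f \<in> Ar C"
    and Dom_Cmp: "\<lbrakk>f \<in> Ar C; g \<in> Ar C; Dom C g = Cod C f\<rbrakk> \<Longrightarrow> Dom C (Cmp C g f) = Dom C f"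
    and Cod_Cmp: "\<lbrakk>f \<in> Ar C; g \<in> Ar C; Dom C g = Cod C f\<rbrakk> \<Longrightarrow> Cod C (Cmp C g f) = Cod C g"
    and Cmp_Idn_right: "f \<in> Ar C \<Longrightarrow> Cmp C f (Idn C (Dom C f)) = f"
    and Cmp_Idn_left: "f \<in> Ar C \<Longrightarrow> Cmp C (Idn C (Cod C f)) f = f"
    and Cmp_assoc: "\<lbrakk>f \<in> Ar C; g \<in> Ar C; h \<in> Ar C; Dom C g = Cod C f; Dom C h = Cod C g\<rbrakk>
      \<Longrightarrow> Cmp C (Cmp C h g) f = Cmp C h (Cmp C g f)"

definition is_functor ::
  "('o, 'm) cat \<Rightarrow> ('p, 'n) cat \<Rightarrow> ('o \<Rightarrow> 'p) \<Rightarrow> ('m \<Rightarrow> 'n) \<Rightarrow> bool" where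
  "is_functor C D F0 F1 \<longleftrightarrow> category C \<and> category D \<and>
     (\<forall>x\<in>Ob C. F0 x \<in> Ob D) \<and>
     (\<forall>f\<in>Ar C. F1 f \<in> Ar D \<and> Dom D (F1 f) = F0 (Dom C f) \<and> Cod D (F1 f) = F0 (Cod C f)) \<and>
     (\<forall>x\<in>Ob C. F1 (Idn C x) = Idn D (F0 x)) \<and>
     (\<forall>f\<in>Ar C. \<forall>g\<in>Ar C. Dom C g = Cod C f \<longrightarrow> F1 (Cmp C g f) = Cmp D (F1 g) (F1 f))"

definition is_iso_functor ::
  "('o, 'm) cat \<Rightarrow> ('p, 'n) cat \<Rightarrow> ('o \<Rightarrow> 'p) \<Rightarrow> ('m \<Rightarrow> 'n) \<Rightarrow> bool" where
  "is_iso_functor C D F0 F1 \<longleftrightarrow> is_functor C D F0 F1 \<and>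
     (\<exists>G0 G1. is_functor D C G0 G1 \<and>
        (\<forall>x\<in>Ob C. G0 (F0 x) = x) \<and> (\<forall>f\<in>Ar C. G1 (F1 f) = f) \<and>
        (\<forall>y\<in>Ob D. F0 (G0 y) = y) \<and> (\<forall>g\<in>Ar D. F1 (G1 g) = g))"

definition isomorphic_cat :: "('o, 'm) cat \<Rightarrow> ('p, 'n) cat \<Rightarrow> bool" where
  "isomorphic_cat C D \<longleftrightarrow> (\<exists>F0 F1. is_iso_functor C D F0 F1)"

definition terminal_cat :: "(unit, unit) cat" where
  "terminal_cat = \<lparr>Ob = {()}, Ar = {()}, Dom = (\<lambda>_. ()), Cod = (\<lambda>_. ()),
     Idn = (\<lambda>_. ()), Cmp = (\<lambda>_ _. ())\<rparr>"

section \<open>Strict 2-categories\<close>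

text \<open>Compositions are written in applicative order: \<open>comp C g f\<close> is \<open>g\<close> after \<open>f\<close>,
  \<open>vcomp C b a\<close> is the juxtaposition \<open>b a\<close>, and \<open>hcomp C b a\<close> is \<open>b * a\<close>.\<close>

record ('o, 'm, 'c) two_cat =
  Obj   :: "'o set"
  Mor   :: "'m set"
  Cel   :: "'c set"
  src   :: "'m \<Rightarrow> 'o"
  tgt   :: "'m \<Rightarrow> 'o"
  one   :: "'o \<Rightarrow> 'm"
  comp  :: "'m \<Rightarrow> 'm \<Rightarrow> 'm"
  vsrc  :: "'c \<Rightarrow> 'm"
  vtgt  :: "'c \<Rightarrow> 'm"
  vone  :: "'m \<Rightarrow> 'c"
  vcomp :: "'c \<Rightarrow> 'c \<Rightarrow> 'c"
  hcomp :: "'c \<Rightarrow> 'c \<Rightarrow> 'c"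

definition und_cat :: "('o, 'm, 'c) two_cat \<Rightarrow> ('o, 'm) cat" where
  "und_cat C = \<lparr>Ob = Obj C, Ar = Mor C, Dom = src C, Cod = tgt C, Idn = one C, Cmp = comp C\<rparr>"

definition vert_cat :: "('o, 'm, 'c) two_cat \<Rightarrow> ('m, 'c) cat" where
  "vert_cat C = \<lparr>Ob = Mor C, Ar = Cel C, Dom = vsrc C, Cod = vtgt C, Idn = vone C, Cmp = vcomp C\<rparr>"

definition horz_cat :: "('o, 'm, 'c) two_cat \<Rightarrow> ('o, 'c) cat" where
  "horz_cat C = \<lparr>Ob = Obj C, Ar = Cel C, Dom = (\<lambda>a. src C (vsrc C a)), Cod = (\<lambda>a. tgt C (vsrc C a)),
     Idn = (\<lambda>x. vone C (one C x)), Cmp = hcomp C\<rparr>"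

locale two_category =
  fixes C :: "('o, 'm, 'c) two_cat"
  assumes und: "category (und_cat C)"
    and vert: "category (vert_cat C)"
    and horz: "category (horz_cat C)"
    and globular_src: "a \<in> Cel C \<Longrightarrow> src C (vtgt C a) = src C (vsrc C a)"
    and globular_tgt: "a \<in> Cel C \<Longrightarrow> tgt C (vtgt C a) = tgt C (vsrc C a)"
    and vsrc_hcomp: "\<lbrakk>a \<in> Cel C; b \<in> Cel C; src C (vsrc C b) = tgt C (vsrc C a)\<rbrakk>
      \<Longrightarrow> vsrc C (hcomp C b a) = comp C (vsrc C b) (vsrc C a)"
    and vtgt_hcomp: "\<lbrakk>a \<in> Cel C; b \<in> Cel C; src C (vsrc C b) = tgt C (vsrc C a)\<rbrakk>
      \<Longrightarrow> vtgt C (hcomp C b a) = comp C (vtgt C b) (vtgt C a)"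
    and hcomp_vone: "\<lbrakk>f \<in> Mor C; g \<in> Mor C; src C g = tgt C f\<rbrakk>
      \<Longrightarrow> hcomp C (vone C g) (vone C f) = vone C (comp C g f)"
    and interchange: "\<lbrakk>a \<in> Cel C; a' \<in> Cel C; b \<in> Cel C; b' \<in> Cel C;
        vsrc C a' = vtgt C a; vsrc C b' = vtgt C b; src C (vsrc C b) = tgt C (vsrc C a)\<rbrakk>
      \<Longrightarrow> hcomp C (vcomp C b' b) (vcomp C a' a) = vcomp C (hcomp C b' a') (hcomp C b a)"

definition lwhisker :: "('o, 'm, 'c) two_cat \<Rightarrow> 'm \<Rightarrow> 'c \<Rightarrow> 'c" where
  "lwhisker C g a = hcomp C (vone C g) a"

definition rwhisker :: "('o, 'm, 'c) two_cat \<Rightarrow> 'c \<Rightarrow> 'm \<Rightarrow> 'c" where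
  "rwhisker C a f = hcomp C a (vone C f)"

definition hom_cat :: "('o, 'm, 'c) two_cat \<Rightarrow> 'o \<Rightarrow> 'o \<Rightarrow> ('m, 'c) cat" where
  "hom_cat C x y = \<lparr>Ob = {f \<in> Mor C. src C f = x \<and> tgt C f = y},
     Ar = {a \<in> Cel C. src C (vsrc C a) = x \<and> tgt C (vsrc C a) = y},
     Dom = vsrc C, Cod = vtgt C, Idn = vone C, Cmp = vcomp C\<rparr>"

definition two_terminal :: "('o, 'm, 'c) two_cat \<Rightarrow> 'o \<Rightarrow> bool" where
  "two_terminal C t \<longleftrightarrow> t \<in> Obj C \<and> (\<forall>x\<in>Obj C. isomorphic_cat (hom_cat C x t) terminal_cat)"

definition locally_discrete :: "('o, 'm) cat \<Rightarrow> ('o, 'm, 'm) two_cat" where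
  "locally_discrete K = \<lparr>Obj = Ob K, Mor = Ar K, Cel = Ar K,
     src = Dom K, tgt = Cod K, one = Idn K, comp = Cmp K,
     vsrc = (\<lambda>f. f), vtgt = (\<lambda>f. f), vone = (\<lambda>f. f), vcomp = (\<lambda>g f. f), hcomp = Cmp K\<rparr>"

section \<open>The 2-category of 2-functors\<close>

text \<open>2-functors, transformations and modifications are required to be extensional (equal to
  \<open>undefined\<close> off the carriers), so that HOL equality of them is equality on the carriers.
  Transformations and modifications carry their source and target.\<close>

record ('o, 'm, 'c, 'p, 'n, 'd) two_fun =
  fob  :: "'o \<Rightarrow> 'p"
  fmor :: "'m \<Rightarrow> 'n"
  fcel :: "'c \<Rightarrow> 'd"

definition is_two_functor ::
  "('o, 'm, 'c) two_cat \<Rightarrow> ('p, 'n, 'd) two_cat \<Rightarrow> ('o, 'm, 'c, 'p, 'n, 'd) two_fun \<Rightarrow> bool" where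
  "is_two_functor C D F \<longleftrightarrow> two_category C \<and> two_category D \<and>
     is_functor (und_cat C) (und_cat D) (fob F) (fmor F) \<and>
     is_functor (vert_cat C) (vert_cat D) (fmor F) (fcel F) \<and>
     is_functor (horz_cat C) (horz_cat D) (fob F) (fcel F) \<and>
     fob F \<in> extensional (Obj C) \<and> fmor F \<in> extensional (Mor C) \<and> fcel F \<in> extensional (Cel C)"

record ('o, 'm, 'c, 'p, 'n, 'd) two_nat =
  nsrc :: "('o, 'm, 'c, 'p, 'n, 'd) two_fun"
  ntgt :: "('o, 'm, 'c, 'p, 'n, 'd) two_fun"
  ncmp :: "'o \<Rightarrow> 'n"

definition is_two_nat ::
  "('o, 'm, 'c) two_cat \<Rightarrow> ('p, 'n, 'd) two_cat \<Rightarrow> ('o, 'm, 'c, 'p, 'n, 'd) two_nat \<Rightarrow> bool" where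
  "is_two_nat J A \<mu> \<longleftrightarrow> is_two_functor J A (nsrc \<mu>) \<and> is_two_functor J A (ntgt \<mu>) \<and>
     (\<forall>i\<in>Obj J. ncmp \<mu> i \<in> Mor A \<and> src A (ncmp \<mu> i) = fob (nsrc \<mu>) i
                 \<and> tgt A (ncmp \<mu> i) = fob (ntgt \<mu>) i) \<and>
     (\<forall>u\<in>Mor J. comp A (fmor (ntgt \<mu>) u) (ncmp \<mu> (src J u))
                 = comp A (ncmp \<mu> (tgt J u)) (fmor (nsrc \<mu>) u)) \<and>
     (\<forall>a\<in>Cel J. rwhisker A (fcel (ntgt \<mu>) a) (ncmp \<mu> (src J (vsrc J a)))
                 = lwhisker A (ncmp \<mu> (tgt J (vsrc J a))) (fcel (nsrc \<mu>) a)) \<and>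
     ncmp \<mu> \<in> extensional (Obj J)"

record ('o, 'm, 'c, 'p, 'n, 'd) two_mod =
  msrc :: "('o, 'm, 'c, 'p, 'n, 'd) two_nat"
  mtgt :: "('o, 'm, 'c, 'p, 'n, 'd) two_nat"
  mcmp :: "'o \<Rightarrow> 'd"

definition is_modification ::
  "('o, 'm, 'c) two_cat \<Rightarrow> ('p, 'n, 'd) two_cat \<Rightarrow> ('o, 'm, 'c, 'p, 'n, 'd) two_mod \<Rightarrow> bool" where
  "is_modification J A \<phi> \<longleftrightarrow> is_two_nat J A (msrc \<phi>) \<and> is_two_nat J A (mtgt \<phi>) \<and>
     nsrc (msrc \<phi>) = nsrc (mtgt \<phi>) \<and> ntgt (msrc \<phi>) = ntgt (mtgt \<phi>) \<and>
     (\<forall>i\<in>Obj J. mcmp \<phi> i \<in> Cel A \<and> vsrc A (mcmp \<phi> i) = ncmp (msrc \<phi>) i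
                 \<and> vtgt A (mcmp \<phi> i) = ncmp (mtgt \<phi>) i) \<and>
     (\<forall>u\<in>Mor J. lwhisker A (fmor (ntgt (msrc \<phi>)) u) (mcmp \<phi> (src J u))
                 = rwhisker A (mcmp \<phi> (tgt J u)) (fmor (nsrc (msrc \<phi>)) u)) \<and>
     mcmp \<phi> \<in> extensional (Obj J)"

definition nat_one ::
  "('o, 'm, 'c) two_cat \<Rightarrow> ('p, 'n, 'd) two_cat \<Rightarrow> ('o, 'm, 'c, 'p, 'n, 'd) two_fun
     \<Rightarrow> ('o, 'm, 'c, 'p, 'n, 'd) two_nat" where
  "nat_one J A F = \<lparr>nsrc = F, ntgt = F, ncmp = (\<lambda>i\<in>Obj J. one A (fob F i))\<rparr>"

definition nat_comp ::
  "('o, 'm, 'c) two_cat \<Rightarrow> ('p, 'n, 'd) two_cat \<Rightarrow> ('o, 'm, 'c, 'p, 'n, 'd) two_nat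
     \<Rightarrow> ('o, 'm, 'c, 'p, 'n, 'd) two_nat \<Rightarrow> ('o, 'm, 'c, 'p, 'n, 'd) two_nat" where
  "nat_comp J A \<nu> \<mu> = \<lparr>nsrc = nsrc \<mu>, ntgt = ntgt \<nu>,
     ncmp = (\<lambda>i\<in>Obj J. comp A (ncmp \<nu> i) (ncmp \<mu> i))\<rparr>"

definition mod_one ::
  "('o, 'm, 'c) two_cat \<Rightarrow> ('p, 'n, 'd) two_cat \<Rightarrow> ('o, 'm, 'c, 'p, 'n, 'd) two_nat
     \<Rightarrow> ('o, 'm, 'c, 'p, 'n, 'd) two_mod" where
  "mod_one J A \<mu> = \<lparr>msrc = \<mu>, mtgt = \<mu>, mcmp = (\<lambda>i\<in>Obj J. vone A (ncmp \<mu> i))\<rparr>"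

definition mod_vcomp ::
  "('o, 'm, 'c) two_cat \<Rightarrow> ('p, 'n, 'd) two_cat \<Rightarrow> ('o, 'm, 'c, 'p, 'n, 'd) two_mod
     \<Rightarrow> ('o, 'm, 'c, 'p, 'n, 'd) two_mod \<Rightarrow> ('o, 'm, 'c, 'p, 'n, 'd) two_mod" where
  "mod_vcomp J A \<psi> \<phi> = \<lparr>msrc = msrc \<phi>, mtgt = mtgt \<psi>,
     mcmp = (\<lambda>i\<in>Obj J. vcomp A (mcmp \<psi> i) (mcmp \<phi> i))\<rparr>"

definition mod_hcomp ::
  "('o, 'm, 'c) two_cat \<Rightarrow> ('p, 'n, 'd) two_cat \<Rightarrow> ('o, 'm, 'c, 'p, 'n, 'd) two_mod
     \<Rightarrow> ('o, 'm, 'c, 'p, 'n, 'd) two_mod \<Rightarrow> ('o, 'm, 'c, 'p, 'n, 'd) two_mod" where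
  "mod_hcomp J A \<psi> \<phi> = \<lparr>msrc = nat_comp J A (msrc \<psi>) (msrc \<phi>), mtgt = nat_comp J A (mtgt \<psi>) (mtgt \<phi>),
     mcmp = (\<lambda>i\<in>Obj J. hcomp A (mcmp \<psi> i) (mcmp \<phi> i))\<rparr>"

definition fun_two_cat ::
  "('o, 'm, 'c) two_cat \<Rightarrow> ('p, 'n, 'd) two_cat \<Rightarrow>
     (('o, 'm, 'c, 'p, 'n, 'd) two_fun, ('o, 'm, 'c, 'p, 'n, 'd) two_nat,
      ('o, 'm, 'c, 'p, 'n, 'd) two_mod) two_cat" where
  "fun_two_cat J A = \<lparr>Obj = {F. is_two_functor J A F}, Mor = {\<mu>. is_two_nat J A \<mu>},
     Cel = {\<phi>. is_modification J A \<phi>},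
     src = nsrc, tgt = ntgt, one = nat_one J A, comp = nat_comp J A,
     vsrc = msrc, vtgt = mtgt, vone = mod_one J A, vcomp = mod_vcomp J A, hcomp = mod_hcomp J A\<rparr>"

section \<open>2-cones, 2-limits and the lax slice\<close>

definition diag_ob ::
  "('o, 'm, 'c) two_cat \<Rightarrow> ('p, 'n, 'd) two_cat \<Rightarrow> 'p \<Rightarrow> ('o, 'm, 'c, 'p, 'n, 'd) two_fun" where
  "diag_ob J A x = \<lparr>fob = (\<lambda>i\<in>Obj J. x), fmor = (\<lambda>u\<in>Mor J. one A x),
     fcel = (\<lambda>a\<in>Cel J. vone A (one A x))\<rparr>"

definition diag_mor ::
  "('o, 'm, 'c) two_cat \<Rightarrow> ('p, 'n, 'd) two_cat \<Rightarrow> 'n \<Rightarrow> ('o, 'm, 'c, 'p, 'n, 'd) two_nat" where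
  "diag_mor J A f = \<lparr>nsrc = diag_ob J A (src A f), ntgt = diag_ob J A (tgt A f),
     ncmp = (\<lambda>i\<in>Obj J. f)\<rparr>"

definition diag_cel ::
  "('o, 'm, 'c) two_cat \<Rightarrow> ('p, 'n, 'd) two_cat \<Rightarrow> 'd \<Rightarrow> ('o, 'm, 'c, 'p, 'n, 'd) two_mod" where
  "diag_cel J A a = \<lparr>msrc = diag_mor J A (vsrc A a), mtgt = diag_mor J A (vtgt A a),
     mcmp = (\<lambda>i\<in>Obj J. a)\<rparr>"

definition is_two_cone ::
  "('o, 'm, 'c) two_cat \<Rightarrow> ('p, 'n, 'd) two_cat \<Rightarrow> ('o, 'm, 'c, 'p, 'n, 'd) two_fun
     \<Rightarrow> 'p \<Rightarrow> ('o, 'm, 'c, 'p, 'n, 'd) two_nat \<Rightarrow> bool" where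
  "is_two_cone J A F x \<mu> \<longleftrightarrow> x \<in> Obj A \<and> is_two_nat J A \<mu> \<and> nsrc \<mu> = diag_ob J A x \<and> ntgt \<mu> = F"

definition is_two_limit ::
  "('o, 'm, 'c) two_cat \<Rightarrow> ('p, 'n, 'd) two_cat \<Rightarrow> ('o, 'm, 'c, 'p, 'n, 'd) two_fun
     \<Rightarrow> 'p \<Rightarrow> ('o, 'm, 'c, 'p, 'n, 'd) two_nat \<Rightarrow> bool" where
  "is_two_limit J A F l \<kappa> \<longleftrightarrow> is_two_cone J A F l \<kappa> \<and>
     (\<forall>x\<in>Obj A. is_iso_functor (hom_cat A x l) (hom_cat (fun_two_cat J A) (diag_ob J A x) F)
        (\<lambda>f. comp (fun_two_cat J A) \<kappa> (diag_mor J A f))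
        (\<lambda>a. lwhisker (fun_two_cat J A) \<kappa> (diag_cel J A a)))"

text \<open>Objects of the lax slice are pairs \<open>(x, \<mu>)\<close>; its morphisms and 2-morphisms carry their source
  and target besides the data \<open>(f, \<phi>)\<close> and \<open>\<alpha>\<close>.\<close>

type_synonym ('o, 'm, 'c, 'p, 'n, 'd) lax_ob = "'p \<times> ('o, 'm, 'c, 'p, 'n, 'd) two_nat"

record ('o, 'm, 'c, 'p, 'n, 'd) lax_mor =
  lsrc :: "('o, 'm, 'c, 'p, 'n, 'd) lax_ob"
  ltgt :: "('o, 'm, 'c, 'p, 'n, 'd) lax_ob"
  lmor :: "'n"
  lmod :: "('o, 'm, 'c, 'p, 'n, 'd) two_mod"

record ('o, 'm, 'c, 'p, 'n, 'd) lax_cel =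
  lvsrc :: "('o, 'm, 'c, 'p, 'n, 'd) lax_mor"
  lvtgt :: "('o, 'm, 'c, 'p, 'n, 'd) lax_mor"
  lcel  :: "'d"

definition is_lax_mor ::
  "('o, 'm, 'c) two_cat \<Rightarrow> ('p, 'n, 'd) two_cat \<Rightarrow> ('o, 'm, 'c, 'p, 'n, 'd) two_fun
     \<Rightarrow> ('o, 'm, 'c, 'p, 'n, 'd) lax_mor \<Rightarrow> bool" where
  "is_lax_mor J A F p \<longleftrightarrow>
     is_two_cone J A F (fst (lsrc p)) (snd (lsrc p)) \<and>
     is_two_cone J A F (fst (ltgt p)) (snd (ltgt p)) \<and>
     lmor p \<in> Mor A \<and> src A (lmor p) = fst (lsrc p) \<and> tgt A (lmor p) = fst (ltgt p) \<and>
     is_modification J A (lmod p) \<and>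
     msrc (lmod p) = comp (fun_two_cat J A) (snd (ltgt p)) (diag_mor J A (lmor p)) \<and>
     mtgt (lmod p) = snd (lsrc p)"

definition is_lax_cel ::
  "('o, 'm, 'c) two_cat \<Rightarrow> ('p, 'n, 'd) two_cat \<Rightarrow> ('o, 'm, 'c, 'p, 'n, 'd) two_fun
     \<Rightarrow> ('o, 'm, 'c, 'p, 'n, 'd) lax_cel \<Rightarrow> bool" where
  "is_lax_cel J A F a \<longleftrightarrow>
     is_lax_mor J A F (lvsrc a) \<and> is_lax_mor J A F (lvtgt a) \<and>
     lsrc (lvsrc a) = lsrc (lvtgt a) \<and> ltgt (lvsrc a) = ltgt (lvtgt a) \<and>
     lcel a \<in> Cel A \<and> vsrc A (lcel a) = lmor (lvsrc a) \<and> vtgt A (lcel a) = lmor (lvtgt a) \<and>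
     vcomp (fun_two_cat J A) (lmod (lvtgt a))
       (lwhisker (fun_two_cat J A) (snd (ltgt (lvsrc a))) (diag_cel J A (lcel a)))
     = lmod (lvsrc a)"

definition lax_one ::
  "('o, 'm, 'c) two_cat \<Rightarrow> ('p, 'n, 'd) two_cat \<Rightarrow> ('o, 'm, 'c, 'p, 'n, 'd) lax_ob
     \<Rightarrow> ('o, 'm, 'c, 'p, 'n, 'd) lax_mor" where
  "lax_one J A z = \<lparr>lsrc = z, ltgt = z, lmor = one A (fst z), lmod = vone (fun_two_cat J A) (snd z)\<rparr>"

text \<open>For \<open>p = (f, \<phi>)\<close> into \<open>(Y, \<nu>)\<close> and \<open>q = (g, \<psi>)\<close> from \<open>(Y, \<nu>)\<close> to \<open>(Z, \<xi>)\<close>, the composite is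
  \<open>(g f, \<phi> (\<psi> * \<Delta>f))\<close>, the second component being the pasting
  \<open>\<xi> \<Delta>g \<Delta>f \<Rightarrow> \<nu> \<Delta>f \<Rightarrow> \<mu>\<close>.\<close>

definition lax_comp ::
  "('o, 'm, 'c) two_cat \<Rightarrow> ('p, 'n, 'd) two_cat \<Rightarrow> ('o, 'm, 'c, 'p, 'n, 'd) lax_mor
     \<Rightarrow> ('o, 'm, 'c, 'p, 'n, 'd) lax_mor \<Rightarrow> ('o, 'm, 'c, 'p, 'n, 'd) lax_mor" where
  "lax_comp J A q p = \<lparr>lsrc = lsrc p, ltgt = ltgt q, lmor = comp A (lmor q) (lmor p),
     lmod = vcomp (fun_two_cat J A) (lmod p)
              (rwhisker (fun_two_cat J A) (lmod q) (diag_mor J A (lmor p)))\<rparr>"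

definition lax_slice ::
  "('o, 'm, 'c) two_cat \<Rightarrow> ('p, 'n, 'd) two_cat \<Rightarrow> ('o, 'm, 'c, 'p, 'n, 'd) two_fun \<Rightarrow>
     (('o, 'm, 'c, 'p, 'n, 'd) lax_ob, ('o, 'm, 'c, 'p, 'n, 'd) lax_mor,
      ('o, 'm, 'c, 'p, 'n, 'd) lax_cel) two_cat" where
  "lax_slice J A F = \<lparr>Obj = {z. is_two_cone J A F (fst z) (snd z)},
     Mor = {p. is_lax_mor J A F p}, Cel = {a. is_lax_cel J A F a},
     src = lsrc, tgt = ltgt, one = lax_one J A, comp = lax_comp J A,
     vsrc = lvsrc, vtgt = lvtgt,
     vone = (\<lambda>p. \<lparr>lvsrc = p, lvtgt = p, lcel = vone A (lmor p)\<rparr>),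
     vcomp = (\<lambda>b a. \<lparr>lvsrc = lvsrc a, lvtgt = lvtgt b, lcel = vcomp A (lcel b) (lcel a)\<rparr>),
     hcomp = (\<lambda>b a. \<lparr>lvsrc = lax_comp J A (lvsrc b) (lvsrc a),
       lvtgt = lax_comp J A (lvtgt b) (lvtgt a), lcel = hcomp A (lcel b) (lcel a)\<rparr>)\<rparr>"

section \<open>2-categories given by generators and relations\<close>

text \<open>Morphisms and 2-morphisms of the presented 2-category are well-formed terms in the generators,
  modulo the smallest congruence containing the 2-category axioms and the given relations.\<close>

datatype ('o, 'm) mterm = MId 'o | MGen 'm | MComp "('o, 'm) mterm" "('o, 'm) mterm"

datatype ('o, 'm, 'g) cterm = CId "('o, 'm) mterm" | CGen 'g
  | VComp "('o, 'm, 'g) cterm" "('o, 'm, 'g) cterm"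
  | HComp "('o, 'm, 'g) cterm" "('o, 'm, 'g) cterm"

record ('o, 'm, 'g) presentation =
  gob   :: "'o set"
  gmor  :: "'m set"
  gsrc  :: "'m \<Rightarrow> 'o"
  gtgt  :: "'m \<Rightarrow> 'o"
  mrel  :: "(('o, 'm) mterm \<times> ('o, 'm) mterm) set"
  gcel  :: "'g set"
  gvsrc :: "'g \<Rightarrow> ('o, 'm) mterm"
  gvtgt :: "'g \<Rightarrow> ('o, 'm) mterm"
  crel  :: "(('o, 'm, 'g) cterm \<times> ('o, 'm, 'g) cterm) set"

context
  fixes P :: "('o, 'm, 'g) presentation"
begin

fun msource :: "('o, 'm) mterm \<Rightarrow> 'o" where
  "msource (MId x) = x"
| "msource (MGen m) = gsrc P m"
| "msource (MComp g f) = msource f"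

fun mtarget :: "('o, 'm) mterm \<Rightarrow> 'o" where
  "mtarget (MId x) = x"
| "mtarget (MGen m) = gtgt P m"
| "mtarget (MComp g f) = mtarget g"

fun mwf :: "('o, 'm) mterm \<Rightarrow> bool" where
  "mwf (MId x) \<longleftrightarrow> x \<in> gob P"
| "mwf (MGen m) \<longleftrightarrow> m \<in> gmor P"
| "mwf (MComp g f) \<longleftrightarrow> mwf g \<and> mwf f \<and> msource g = mtarget f"

inductive meq :: "('o, 'm) mterm \<Rightarrow> ('o, 'm) mterm \<Rightarrow> bool" where
  meq_refl: "mwf f \<Longrightarrow> meq f f"
| meq_sym: "meq f g \<Longrightarrow> meq g f"
| meq_trans: "\<lbrakk>meq f g; meq g h\<rbrakk> \<Longrightarrow> meq f h"
| meq_comp: "\<lbrakk>meq g g'; meq f f'; msource g = mtarget f\<rbrakk> \<Longrightarrow> meq (MComp g f) (MComp g' f')"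
| meq_unit_right: "mwf f \<Longrightarrow> meq (MComp f (MId (msource f))) f"
| meq_unit_left: "mwf f \<Longrightarrow> meq (MComp (MId (mtarget f)) f) f"
| meq_assoc: "\<lbrakk>mwf h; mwf g; mwf f; msource h = mtarget g; msource g = mtarget f\<rbrakk>
    \<Longrightarrow> meq (MComp (MComp h g) f) (MComp h (MComp g f))"
| meq_rel: "(f, g) \<in> mrel P \<Longrightarrow> meq f g"

fun csource :: "('o, 'm, 'g) cterm \<Rightarrow> ('o, 'm) mterm" where
  "csource (CId f) = f"
| "csource (CGen a) = gvsrc P a"
| "csource (VComp b a) = csource a"
| "csource (HComp b a) = MComp (csource b) (csource a)"

fun ctarget :: "('o, 'm, 'g) cterm \<Rightarrow> ('o, 'm) mterm" where
  "ctarget (CId f) = f"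
| "ctarget (CGen a) = gvtgt P a"
| "ctarget (VComp b a) = ctarget b"
| "ctarget (HComp b a) = MComp (ctarget b) (ctarget a)"

fun cwf :: "('o, 'm, 'g) cterm \<Rightarrow> bool" where
  "cwf (CId f) \<longleftrightarrow> mwf f"
| "cwf (CGen a) \<longleftrightarrow> a \<in> gcel P"
| "cwf (VComp b a) \<longleftrightarrow> cwf b \<and> cwf a \<and> meq (csource b) (ctarget a)"
| "cwf (HComp b a) \<longleftrightarrow> cwf b \<and> cwf a \<and> msource (csource b) = mtarget (csource a)"

inductive ceq :: "('o, 'm, 'g) cterm \<Rightarrow> ('o, 'm, 'g) cterm \<Rightarrow> bool" where
  ceq_refl: "cwf a \<Longrightarrow> ceq a a"
| ceq_sym: "ceq a b \<Longrightarrow> ceq b a"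
| ceq_trans: "\<lbrakk>ceq a b; ceq b c\<rbrakk> \<Longrightarrow> ceq a c"
| ceq_id: "meq f g \<Longrightarrow> ceq (CId f) (CId g)"
| ceq_vcomp: "\<lbrakk>ceq b b'; ceq a a'; meq (csource b) (ctarget a)\<rbrakk> \<Longrightarrow> ceq (VComp b a) (VComp b' a')"
| ceq_hcomp: "\<lbrakk>ceq b b'; ceq a a'; msource (csource b) = mtarget (csource a)\<rbrakk>
    \<Longrightarrow> ceq (HComp b a) (HComp b' a')"
| ceq_vunit_right: "cwf a \<Longrightarrow> ceq (VComp a (CId (csource a))) a"
| ceq_vunit_left: "cwf a \<Longrightarrow> ceq (VComp (CId (ctarget a)) a) a"
| ceq_vassoc: "\<lbrakk>cwf c; cwf b; cwf a; meq (csource c) (ctarget b); meq (csource b) (ctarget a)\<rbrakk>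
    \<Longrightarrow> ceq (VComp (VComp c b) a) (VComp c (VComp b a))"
| ceq_hunit_right: "cwf a \<Longrightarrow> ceq (HComp a (CId (MId (msource (csource a))))) a"
| ceq_hunit_left: "cwf a \<Longrightarrow> ceq (HComp (CId (MId (mtarget (csource a)))) a) a"
| ceq_hassoc: "\<lbrakk>cwf c; cwf b; cwf a; msource (csource c) = mtarget (csource b);
      msource (csource b) = mtarget (csource a)\<rbrakk>
    \<Longrightarrow> ceq (HComp (HComp c b) a) (HComp c (HComp b a))"
| ceq_hid: "\<lbrakk>mwf g; mwf f; msource g = mtarget f\<rbrakk> \<Longrightarrow> ceq (HComp (CId g) (CId f)) (CId (MComp g f))"
| ceq_interchange: "\<lbrakk>cwf b'; cwf b; cwf a'; cwf a; meq (csource b') (ctarget b);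
      meq (csource a') (ctarget a); msource (csource b) = mtarget (csource a)\<rbrakk>
    \<Longrightarrow> ceq (HComp (VComp b' b) (VComp a' a)) (VComp (HComp b' a') (HComp b a))"
| ceq_rel: "(a, b) \<in> crel P \<Longrightarrow> ceq a b"

definition mclass :: "('o, 'm) mterm \<Rightarrow> ('o, 'm) mterm set" where
  "mclass f = {g. meq f g}"

definition cclass :: "('o, 'm, 'g) cterm \<Rightarrow> ('o, 'm, 'g) cterm set" where
  "cclass a = {b. ceq a b}"

definition mrep :: "('o, 'm) mterm set \<Rightarrow> ('o, 'm) mterm" where
  "mrep u = (SOME f. f \<in> u)"

definition crep :: "('o, 'm, 'g) cterm set \<Rightarrow> ('o, 'm, 'g) cterm" where
  "crep u = (SOME a. a \<in> u)"

text \<open>The relations must hold between parallel terms; this makes the operations below, which are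
  computed on chosen representatives, independent of the choice.\<close>

definition wf_presentation :: bool where
  "wf_presentation \<longleftrightarrow>
     (\<forall>m\<in>gmor P. gsrc P m \<in> gob P \<and> gtgt P m \<in> gob P) \<and>
     (\<forall>(f, g)\<in>mrel P. mwf f \<and> mwf g \<and> msource f = msource g \<and> mtarget f = mtarget g) \<and>
     (\<forall>a\<in>gcel P. mwf (gvsrc P a) \<and> mwf (gvtgt P a) \<and>
        msource (gvsrc P a) = msource (gvtgt P a) \<and> mtarget (gvsrc P a) = mtarget (gvtgt P a)) \<and>
     (\<forall>(a, b)\<in>crel P. cwf a \<and> cwf b \<and> meq (csource a) (csource b) \<and> meq (ctarget a) (ctarget b))"

definition presented :: "('o, ('o, 'm) mterm set, ('o, 'm, 'g) cterm set) two_cat" where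
  "presented = \<lparr>Obj = gob P, Mor = {mclass f | f. mwf f}, Cel = {cclass a | a. cwf a},
     src = (\<lambda>u. msource (mrep u)), tgt = (\<lambda>u. mtarget (mrep u)),
     one = (\<lambda>x. mclass (MId x)), comp = (\<lambda>v u. mclass (MComp (mrep v) (mrep u))),
     vsrc = (\<lambda>u. mclass (csource (crep u))), vtgt = (\<lambda>u. mclass (ctarget (crep u))),
     vone = (\<lambda>u. cclass (CId (mrep u))),
     vcomp = (\<lambda>v u. cclass (VComp (crep v) (crep u))),
     hcomp = (\<lambda>v u. cclass (HComp (crep v) (crep u)))\<rparr>"

end

section \<open>The example\<close>

datatype cospan_ob = Lft | Mid | Rgt

text \<open>The only non-identity arrows of the pullback shape are \<open>(Lft, Mid)\<close> and \<open>(Rgt, Mid)\<close>.\<close>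

definition cospan_cat :: "(cospan_ob, cospan_ob \<times> cospan_ob) cat" where
  "cospan_cat = \<lparr>Ob = UNIV, Ar = {(i, j). i = j \<or> j = Mid}, Dom = fst, Cod = snd,
     Idn = (\<lambda>i. (i, i)), Cmp = (\<lambda>v u. (fst u, snd v))\<rparr>"

definition cospan :: "(cospan_ob, cospan_ob \<times> cospan_ob, cospan_ob \<times> cospan_ob) two_cat" where
  "cospan = locally_discrete cospan_cat"

datatype ex_ob = obX | obL | obA | obB | obC
datatype ex_mor = mor_f | mor_g | mor_l0 | mor_l1 | mor_b | mor_c
datatype ex_cel = cel_alpha

fun ex_src :: "ex_mor \<Rightarrow> ex_ob" where
  "ex_src mor_f = obX"
| "ex_src mor_g = obX"
| "ex_src mor_l0 = obL"
| "ex_src mor_l1 = obL"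
| "ex_src mor_b = obB"
| "ex_src mor_c = obC"

fun ex_tgt :: "ex_mor \<Rightarrow> ex_ob" where
  "ex_tgt mor_f = obL"
| "ex_tgt mor_g = obL"
| "ex_tgt mor_l0 = obB"
| "ex_tgt mor_l1 = obC"
| "ex_tgt mor_b = obA"
| "ex_tgt mor_c = obA"

definition ex_pres :: "(ex_ob, ex_mor, ex_cel) presentation" where
  "ex_pres = \<lparr>gob = UNIV, gmor = UNIV, gsrc = ex_src, gtgt = ex_tgt,
     mrel = {(MComp (MGen mor_b) (MGen mor_l0), MComp (MGen mor_c) (MGen mor_l1))},
     gcel = UNIV, gvsrc = (\<lambda>_. MGen mor_f), gvtgt = (\<lambda>_. MGen mor_g),
     crel = {}\<rparr>"

lemma wf_presentation_ex_pres: "wf_presentation ex_pres"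
  by (simp add: wf_presentation_def ex_pres_def)

type_synonym ex_Mor = "(ex_ob, ex_mor) mterm set"
type_synonym ex_Cel = "(ex_ob, ex_mor, ex_cel) cterm set"

definition ex_two_cat :: "(ex_ob, ex_Mor, ex_Cel) two_cat" where
  "ex_two_cat = presented ex_pres"

abbreviation ex_gen :: "ex_mor \<Rightarrow> ex_Mor" where
  "ex_gen m \<equiv> mclass ex_pres (MGen m)"

fun ex_diagram_ob :: "cospan_ob \<Rightarrow> ex_ob" where
  "ex_diagram_ob Lft = obB"
| "ex_diagram_ob Mid = obA"
| "ex_diagram_ob Rgt = obC"

definition ex_diagram_mor :: "cospan_ob \<times> cospan_ob \<Rightarrow> ex_Mor" where
  "ex_diagram_mor u = (if u = (Lft, Mid) then ex_gen mor_b
     else if u = (Rgt, Mid) then ex_gen mor_c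
     else one ex_two_cat (ex_diagram_ob (fst u)))"

definition ex_diagram ::
  "(cospan_ob, cospan_ob \<times> cospan_ob, cospan_ob \<times> cospan_ob, ex_ob, ex_Mor, ex_Cel) two_fun" where
  "ex_diagram = \<lparr>fob = ex_diagram_ob, fmor = (\<lambda>u\<in>Mor cospan. ex_diagram_mor u),
     fcel = (\<lambda>u\<in>Cel cospan. vone ex_two_cat (ex_diagram_mor u))\<rparr>"

fun ex_cone_cmp :: "cospan_ob \<Rightarrow> ex_Mor" where
  "ex_cone_cmp Lft = ex_gen mor_l0"
| "ex_cone_cmp Rgt = ex_gen mor_l1"
| "ex_cone_cmp Mid = comp ex_two_cat (ex_gen mor_b) (ex_gen mor_l0)"

definition ex_cone ::
  "(cospan_ob, cospan_ob \<times> cospan_ob, cospan_ob \<times> cospan_ob, ex_ob, ex_Mor, ex_Cel) two_nat" where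
  "ex_cone = \<lparr>nsrc = diag_ob cospan ex_two_cat obL, ntgt = ex_diagram, ncmp = ex_cone_cmp\<rparr>"

end

theory Submission
  imports Defs
begin

text \<open>
  Tag a morphism by whether it passes through \<open>f\<close>, through \<open>g\<close>, or through neither. A morphism
  of \<open>\<A>\<close> is determined by its source, target and tag, and parallel 2-morphisms are equal, the
  non-identity ones being the whiskerings of \<open>\<alpha>\<close>. A cone over the cospan therefore lives at \<open>L\<close>
  or \<open>X\<close>, its components share one tag, and it is \<open>\<lambda>\<close> precomposed with the morphism into \<open>L\<close>
  carrying that tag; this gives the 2-limit. On the other hand \<open>(f, \<lambda> * \<alpha>)\<close> and \<open>(g, id)\<close> are two
  different morphisms from \<open>(X, \<lambda>g)\<close> to \<open>(L, \<lambda>)\<close> in the lax slice.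
\<close>

section \<open>Presented 2-categories\<close>

text \<open>Equality in \<A> is a word problem on terms. It stays small because no generator ends at
  X: apart from identities, \<open>mor_f\<close> or \<open>mor_g\<close> can only be the first arrow
  applied, so a well-formed term contains at most one of them, once; the relation merely merges the
  two paths from L to A. For the same reason two copies of \<alpha> never compose horizontally, and
  since f and g have different tags they never compose vertically either. Uniqueness of parallel
  2-morphisms then does most of the 2-dimensional work: an equation between 2-cells becomes a
  comparison of boundaries. This is isolated for an arbitrary locally thin target, where it also
  yields that the lax slice is a 2-category, so that 2-terminality in it is meaningful. The two
  conclusions coexist because the 2-limit property tests strict factorizations of cones, while a
  morphism of the lax slice may reach a cone through a non-invertible 2-cell. As \<alpha> points
  from f to g, the cone \<lambda>g is reached both from \<lambda>f and from itself.\<close>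

context
  fixes P :: "('o, 'm, 'g) presentation"
  assumes wf: "wf_presentation P"
begin

lemma mwf_ends: "mwf P f \<Longrightarrow> msource P f \<in> gob P \<and> mtarget P f \<in> gob P"
  by (induction f) (use wf in \<open>auto simp: wf_presentation_def\<close>)

text \<open>Every clause of \<open>meq\<close> preserves endpoints, the relations by
  \<open>wf_presentation\<close>. Hence source and target descend to classes.\<close>

lemma meq_parallel:
  assumes "meq P f g"
  shows "mwf P f \<and> mwf P g \<and> msource P f = msource P g \<and> mtarget P f = mtarget P g"
  using assms
proof induction
  case (meq_rel f g)
  then show ?case using wf unfolding wf_presentation_def by blast
qed (auto simp: mwf_ends)

lemma cwf_boundary:
  "cwf P a \<Longrightarrow> mwf P (csource P a) \<and> mwf P (ctarget P a) \<and>
     msource P (ctarget P a) = msource P (csource P a) \<and>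
     mtarget P (ctarget P a) = mtarget P (csource P a)"
proof (induction a)
  case (VComp b a)
  \<comment> \<open>The two cells of a \<open>VComp\<close> meet only up to \<open>meq\<close>, so
    the endpoints of the outer boundary must be carried across that equivalence.\<close>
  then show ?case using meq_parallel by (metis csource.simps(3) ctarget.simps(3) cwf.simps(3))
qed (use wf in \<open>auto simp: wf_presentation_def\<close>)

text \<open>Boundaries can agree only up to \<open>meq\<close>, not syntactically: the horizontal
  unit laws, for instance, alter the source term by an identity factor.\<close>

lemma ceq_parallel:
  assumes "ceq P a b"
  shows "cwf P a \<and> cwf P b \<and> meq P (csource P a) (csource P b) \<and> meq P (ctarget P a) (ctarget P b)"
  using assms
proof induction
  case (ceq_refl a)
  then show ?case by (simp add: cwf_boundary meq.meq_refl)
next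
  case (ceq_sym a b)
  then show ?case by (blast intro: meq.meq_sym)
next
  case (ceq_trans a b c)
  then show ?case by (blast intro: meq.meq_trans)
next
  case (ceq_id f g)
  then show ?case using meq_parallel by simp
next
  case (ceq_vcomp b b' a a')
  then show ?case by (auto intro: meq.meq_trans meq.meq_sym)
next
  case (ceq_hcomp b b' a a')
  then show ?case using meq_parallel cwf_boundary by (auto intro!: meq.meq_comp)
next
  case (ceq_vunit_right a)
  then show ?case by (simp add: cwf_boundary meq.meq_refl)
next
  case (ceq_vunit_left a)
  then show ?case by (simp add: cwf_boundary meq.meq_refl)
next
  case (ceq_vassoc c b a)
  then show ?case by (simp add: cwf_boundary meq.meq_refl)
next
  case (ceq_hunit_right a)
  then show ?case using cwf_boundary[of a] mwf_ends[of "csource P a"]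
    meq.meq_unit_right[of P "csource P a"] meq.meq_unit_right[of P "ctarget P a"] by auto
next
  case (ceq_hunit_left a)
  then show ?case using cwf_boundary[of a] mwf_ends[of "csource P a"]
    meq.meq_unit_left[of P "csource P a"] meq.meq_unit_left[of P "ctarget P a"] by auto
next
  case (ceq_hassoc c b a)
  then show ?case by (simp add: cwf_boundary meq.meq_assoc)
next
  case (ceq_hid g f)
  then show ?case by (simp add: meq.meq_refl)
next
  case (ceq_interchange b' b a' a)
  then show ?case
    using meq_parallel[of "csource P b'" "ctarget P b"] meq_parallel[of "csource P a'" "ctarget P a"]
    by (simp add: cwf_boundary meq.meq_refl meq.meq_comp)
next
  case (ceq_rel a b)
  then show ?case using wf unfolding wf_presentation_def by blast
qed

section \<open>Operations on classes, computed from arbitrary representatives\<close>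

lemma mclass_eq_iff: "mwf P f \<Longrightarrow> mclass P f = mclass P g \<longleftrightarrow> meq P f g"
  unfolding mclass_def by (auto intro: meq.meq_refl meq.meq_sym meq.meq_trans)

lemma cclass_eq_iff: "cwf P a \<Longrightarrow> cclass P a = cclass P b \<longleftrightarrow> ceq P a b"
  unfolding cclass_def by (auto intro: ceq.ceq_refl ceq.ceq_sym ceq.ceq_trans)

lemma mclass_eqI: "meq P f g \<Longrightarrow> mclass P f = mclass P g"
  using mclass_eq_iff meq_parallel by blast

lemma cclass_eqI: "ceq P a b \<Longrightarrow> cclass P a = cclass P b"
  using cclass_eq_iff ceq_parallel by blast

lemma meq_mrep: "mwf P f \<Longrightarrow> meq P f (mrep (mclass P f))"
  unfolding mrep_def mclass_def
  by (metis (mono_tags, lifting) mem_Collect_eq meq.meq_refl someI)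

lemma ceq_crep: "cwf P a \<Longrightarrow> ceq P a (crep (cclass P a))"
  unfolding crep_def cclass_def
  by (metis (mono_tags, lifting) mem_Collect_eq ceq.ceq_refl someI)

lemma presented_carriers:
  "Obj (presented P) = gob P" "Mor (presented P) = mclass P ` Collect (mwf P)"
  "Cel (presented P) = cclass P ` Collect (cwf P)"
  by (auto simp: presented_def)

lemma presented_src: "mwf P f \<Longrightarrow> src (presented P) (mclass P f) = msource P f"
  and presented_tgt: "mwf P f \<Longrightarrow> tgt (presented P) (mclass P f) = mtarget P f"
  using meq_mrep[of f] meq_parallel[of f "mrep (mclass P f)"] by (simp_all add: presented_def)

lemma presented_one: "one (presented P) x = mclass P (MId x)"
  by (simp add: presented_def)

text \<open>The definition composes chosen representatives; since \<open>meq\<close> is a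
  congruence, any other representatives give the same class. The cell operations below are treated
  alike with \<open>ceq\<close>.\<close>

lemma presented_comp:
  "\<lbrakk>mwf P g; mwf P f; msource P g = mtarget P f\<rbrakk>
    \<Longrightarrow> comp (presented P) (mclass P g) (mclass P f) = mclass P (MComp g f)"
  using meq_mrep[of f] meq_mrep[of g]
  by (simp add: presented_def mclass_eq_iff[symmetric])
    (metis meq.meq_comp mclass_eq_iff mwf.simps(3))

lemma presented_vsrc: "cwf P a \<Longrightarrow> vsrc (presented P) (cclass P a) = mclass P (csource P a)"
  and presented_vtgt: "cwf P a \<Longrightarrow> vtgt (presented P) (cclass P a) = mclass P (ctarget P a)"
  using ceq_parallel[OF ceq_crep[of a]] cwf_boundary[of a]
  by (auto simp: presented_def mclass_eq_iff[symmetric])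

lemma presented_vone: "mwf P f \<Longrightarrow> vone (presented P) (mclass P f) = cclass P (CId f)"
  using meq_mrep[of f]
  by (simp add: presented_def) (metis ceq.ceq_id cclass_eq_iff cwf.simps(1))

lemma presented_vcomp:
  "\<lbrakk>cwf P b; cwf P a; meq P (csource P b) (ctarget P a)\<rbrakk>
    \<Longrightarrow> vcomp (presented P) (cclass P b) (cclass P a) = cclass P (VComp b a)"
  using ceq_crep[of a] ceq_crep[of b]
  by (simp add: presented_def) (metis ceq.ceq_vcomp cclass_eq_iff cwf.simps(3))

lemma presented_hcomp:
  "\<lbrakk>cwf P b; cwf P a; msource P (csource P b) = mtarget P (csource P a)\<rbrakk>
    \<Longrightarrow> hcomp (presented P) (cclass P b) (cclass P a) = cclass P (HComp b a)"
  using ceq_crep[of a] ceq_crep[of b]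
  by (simp add: presented_def) (metis ceq.ceq_hcomp cclass_eq_iff cwf.simps(4))

lemmas presented_simps = presented_carriers presented_src presented_tgt presented_one
  presented_comp presented_vsrc presented_vtgt presented_vone presented_vcomp presented_hcomp

text \<open>Once operations are computed on representatives, the equational laws are clauses of
  \<open>meq\<close> or \<open>ceq\<close>; composability and boundaries come from
  \<open>mwf_ends\<close> and \<open>cwf_boundary\<close>.\<close>

lemma two_category_presented: "two_category (presented P)"
proof (rule two_category.intro)
  show "category (und_cat (presented P))"
    by unfold_locales
      (auto simp: und_cat_def presented_simps mwf_ends meq.meq_unit_left[THEN mclass_eqI]
        meq.meq_unit_right[THEN mclass_eqI] meq.meq_assoc[THEN mclass_eqI])
  show "category (vert_cat (presented P))"
    by unfold_locales
      (auto simp: vert_cat_def presented_simps cwf_boundary mclass_eq_iff meq.meq_refl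
        ceq.ceq_vunit_left[THEN cclass_eqI] ceq.ceq_vunit_right[THEN cclass_eqI] ceq.ceq_vassoc[THEN cclass_eqI])
  show "category (horz_cat (presented P))"
    by unfold_locales
      (auto simp: horz_cat_def presented_simps cwf_boundary mwf_ends
        ceq.ceq_hunit_left[THEN cclass_eqI] ceq.ceq_hunit_right[THEN cclass_eqI] ceq.ceq_hassoc[THEN cclass_eqI])
next
  fix a a' b b'
  assume cells: "a \<in> Cel (presented P)" "a' \<in> Cel (presented P)"
      "b \<in> Cel (presented P)" "b' \<in> Cel (presented P)"
    and bd: "vsrc (presented P) a' = vtgt (presented P) a"
      "vsrc (presented P) b' = vtgt (presented P) b"
      "src (presented P) (vsrc (presented P) b) = tgt (presented P) (vsrc (presented P) a)"
  obtain x x' y y' where t: "cwf P x" "cwf P x'" "cwf P y" "cwf P y'"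
    and eqs: "a = cclass P x" "a' = cclass P x'" "b = cclass P y" "b' = cclass P y'"
    using cells by (auto simp: presented_carriers)
  have v: "meq P (csource P x') (ctarget P x)" "meq P (csource P y') (ctarget P y)"
    and h: "msource P (csource P y) = mtarget P (csource P x)"
    using bd t by (simp_all add: eqs presented_simps cwf_boundary mclass_eq_iff)
  \<comment> \<open>Horizontal composability is given for the lower pair only. It passes to the
    upper pair because vertically composable cells have the same objects as ends.\<close>
  have h': "msource P (csource P y') = mtarget P (csource P x')"
    using h v[THEN meq_parallel] t by (simp add: cwf_boundary)
  then have vh: "meq P (csource P (HComp y' x')) (ctarget P (HComp y x))"
    using v by (simp add: meq.meq_comp)
  show "hcomp (presented P) (vcomp (presented P) b' b) (vcomp (presented P) a' a) =
      vcomp (presented P) (hcomp (presented P) b' a') (hcomp (presented P) b a)"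
    using t v h h' vh ceq.ceq_interchange[THEN cclass_eqI, OF t(4,3,2,1) v(2,1) h]
    by (simp add: eqs presented_hcomp presented_vcomp)
next
  fix f g
  assume "f \<in> Mor (presented P)" "g \<in> Mor (presented P)" "src (presented P) g = tgt (presented P) f"
  then show "hcomp (presented P) (vone (presented P) g) (vone (presented P) f) =
      vone (presented P) (comp (presented P) g f)"
    by (auto simp: presented_simps ceq.ceq_hid[THEN cclass_eqI])
qed (auto simp: presented_simps cwf_boundary)

end

section \<open>Functors and 2-categories\<close>

text \<open>The set-theoretic inverse of a bijective functor is again a functor, so the universal
  property reduces to two bijections.\<close>

lemma is_functor_bij_imp_iso:
  assumes F: "is_functor C D F0 F1"
    and b0: "bij_betw F0 (Ob C) (Ob D)" and b1: "bij_betw F1 (Ar C) (Ar D)"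
  shows "is_iso_functor C D F0 F1"
proof -
  interpret C: category C using F unfolding is_functor_def by blast
  interpret D: category D using F unfolding is_functor_def by blast
  let ?G0 = "the_inv_into (Ob C) F0" and ?G1 = "the_inv_into (Ar C) F1"
  have i0: "inj_on F0 (Ob C)" and i1: "inj_on F1 (Ar C)"
    using b0 b1 by (auto simp: bij_betw_def)
  have o: "\<exists>x. x \<in> Ob C \<and> y = F0 x" if "y \<in> Ob D" for y
    using b0 that unfolding bij_betw_def by blast
  have m: "\<exists>f. f \<in> Ar C \<and> g = F1 f" if "g \<in> Ar D" for g
    using b1 that unfolding bij_betw_def by blast
  have G0: "?G0 (F0 x) = x" if "x \<in> Ob C" for x using the_inv_into_f_f[OF i0 that] .
  have G1: "?G1 (F1 f) = f" if "f \<in> Ar C" for f using the_inv_into_f_f[OF i1 that] .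
  have F_Ar: "F1 f \<in> Ar D" "Dom D (F1 f) = F0 (Dom C f)" "Cod D (F1 f) = F0 (Cod C f)"
    if "f \<in> Ar C" for f using F that unfolding is_functor_def by auto
  have F_Idn: "F1 (Idn C x) = Idn D (F0 x)" if "x \<in> Ob C" for x
    using F that unfolding is_functor_def by auto
  have F_Cmp: "F1 (Cmp C g f) = Cmp D (F1 g) (F1 f)"
    if "f \<in> Ar C" "g \<in> Ar C" "Dom C g = Cod C f" for f g
    using F that unfolding is_functor_def by auto
  have "is_functor D C ?G0 ?G1"
    unfolding is_functor_def
  proof (intro conjI ballI impI)
    fix y assume "y \<in> Ob D"
    then obtain x where x: "x \<in> Ob C" "y = F0 x" using o by blast
    then show "?G0 y \<in> Ob C" by (simp add: G0)
    show "?G1 (Idn D y) = Idn C (?G0 y)" using x by (metis C.Idn_Ar F_Idn G0 G1)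
  next
    fix g assume "g \<in> Ar D"
    then obtain f where f: "f \<in> Ar C" "g = F1 f" using m by blast
    then show "?G1 g \<in> Ar C" "Dom C (?G1 g) = ?G0 (Dom D g)" "Cod C (?G1 g) = ?G0 (Cod D g)"
      by (simp_all add: G1 G0 F_Ar C.Dom_Ob C.Cod_Ob)
  next
    fix g h assume "g \<in> Ar D" "h \<in> Ar D" and c: "Dom D h = Cod D g"
    then obtain f k where f: "f \<in> Ar C" "g = F1 f" "k \<in> Ar C" "h = F1 k" using m by blast
    \<comment> \<open>Composability is reflected, not just preserved, because \<open>F0\<close> is
      injective on objects.\<close>
    moreover have "Dom C k = Cod C f"
      using c f i0 C.Dom_Ob C.Cod_Ob by (metis F_Ar(2,3) G0)
    ultimately show "?G1 (Cmp D h g) = Cmp C (?G1 h) (?G1 g)"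
      by (metis C.Cmp_Ar F_Cmp G1)
  qed (rule D.category_axioms C.category_axioms)+
  then show ?thesis
    unfolding is_iso_functor_def using F G0 G1 o m by (intro conjI exI[of _ ?G0] exI[of _ ?G1]) force+
qed

text \<open>The inverse functor makes every object the image of \<open>()\<close>. This refutes
  2-terminality from two distinct morphisms with the same ends.\<close>

lemma isomorphic_terminal_cat_Ob_unique:
  assumes "isomorphic_cat C terminal_cat" "x \<in> Ob C" "y \<in> Ob C"
  shows "x = y"
proof -
  obtain F0 F1 G0 where "\<forall>x\<in>Ob C. (G0 :: unit \<Rightarrow> 'a) (F0 x) = x"
    using assms(1) unfolding isomorphic_cat_def is_iso_functor_def by blast
  then show ?thesis using assms(2,3) by (metis old.unit.exhaust)
qed

context two_category
begin

lemmas und_laws = und[unfolded category_def und_cat_def, simplified]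
  and vert_laws = vert[unfolded category_def vert_cat_def, simplified]
  and horz_laws = horz[unfolded category_def horz_cat_def, simplified]

lemma src_Obj [simp]: "f \<in> Mor C \<Longrightarrow> src C f \<in> Obj C"
  and tgt_Obj [simp]: "f \<in> Mor C \<Longrightarrow> tgt C f \<in> Obj C"
  and one_Mor [simp]: "x \<in> Obj C \<Longrightarrow> one C x \<in> Mor C"
  and src_one [simp]: "x \<in> Obj C \<Longrightarrow> src C (one C x) = x"
  and tgt_one [simp]: "x \<in> Obj C \<Longrightarrow> tgt C (one C x) = x"
  and comp_Mor [simp]: "\<lbrakk>f \<in> Mor C; g \<in> Mor C; src C g = tgt C f\<rbrakk> \<Longrightarrow> comp C g f \<in> Mor C"
  and src_comp [simp]: "\<lbrakk>f \<in> Mor C; g \<in> Mor C; src C g = tgt C f\<rbrakk> \<Longrightarrow> src C (comp C g f) = src C f"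
  and tgt_comp [simp]: "\<lbrakk>f \<in> Mor C; g \<in> Mor C; src C g = tgt C f\<rbrakk> \<Longrightarrow> tgt C (comp C g f) = tgt C g"
  and comp_one_right: "f \<in> Mor C \<Longrightarrow> comp C f (one C (src C f)) = f"
  and comp_one_left: "f \<in> Mor C \<Longrightarrow> comp C (one C (tgt C f)) f = f"
  and comp_assoc: "\<lbrakk>f \<in> Mor C; g \<in> Mor C; h \<in> Mor C; src C g = tgt C f; src C h = tgt C g\<rbrakk>
    \<Longrightarrow> comp C (comp C h g) f = comp C h (comp C g f)"
  using und_laws by auto

lemma vsrc_Mor [simp]: "a \<in> Cel C \<Longrightarrow> vsrc C a \<in> Mor C"
  and vtgt_Mor [simp]: "a \<in> Cel C \<Longrightarrow> vtgt C a \<in> Mor C"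
  and vone_Cel [simp]: "f \<in> Mor C \<Longrightarrow> vone C f \<in> Cel C"
  and vsrc_vone [simp]: "f \<in> Mor C \<Longrightarrow> vsrc C (vone C f) = f"
  and vtgt_vone [simp]: "f \<in> Mor C \<Longrightarrow> vtgt C (vone C f) = f"
  and vcomp_Cel [simp]: "\<lbrakk>a \<in> Cel C; b \<in> Cel C; vsrc C b = vtgt C a\<rbrakk> \<Longrightarrow> vcomp C b a \<in> Cel C"
  and vsrc_vcomp [simp]: "\<lbrakk>a \<in> Cel C; b \<in> Cel C; vsrc C b = vtgt C a\<rbrakk> \<Longrightarrow> vsrc C (vcomp C b a) = vsrc C a"
  and vtgt_vcomp [simp]: "\<lbrakk>a \<in> Cel C; b \<in> Cel C; vsrc C b = vtgt C a\<rbrakk> \<Longrightarrow> vtgt C (vcomp C b a) = vtgt C b"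
  using vert_laws by auto

lemma hcomp_Cel [simp]:
  "\<lbrakk>a \<in> Cel C; b \<in> Cel C; src C (vsrc C b) = tgt C (vsrc C a)\<rbrakk> \<Longrightarrow> hcomp C b a \<in> Cel C"
  using horz_laws by auto

lemma category_hom_cat: "category (hom_cat C x y)"
  using vert_laws by unfold_locales (auto simp: hom_cat_def globular_src globular_tgt)

end

lemma two_category_locally_discrete:
  assumes "category K" shows "two_category (locally_discrete K)"
proof -
  interpret category K by fact
  show ?thesis
    by unfold_locales
      (auto simp: locally_discrete_def und_cat_def vert_cat_def horz_cat_def Dom_Ob Cod_Ob Idn_Ar
        Dom_Idn Cod_Idn Cmp_Ar Dom_Cmp Cod_Cmp Cmp_Idn_right Cmp_Idn_left Cmp_assoc)
qed

section \<open>Locally thin targets\<close>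

text \<open>Each hom-category of the target is a preorder: a 2-cell carries no information beyond
  its boundary. The shape \<open>J\<close> may be any 2-category.\<close>

locale thin_target = J: two_category J + A: two_category A
  for J :: "('o, 'm, 'c) two_cat" and A :: "('p, 'n, 'd) two_cat" +
  assumes thin: "\<lbrakk>a \<in> Cel A; b \<in> Cel A; vsrc A a = vsrc A b; vtgt A a = vtgt A b\<rbrakk> \<Longrightarrow> a = b"
begin

section \<open>Functors, transformations and modifications into a locally thin target\<close>

lemma two_functorD:
  assumes "is_two_functor J A F"
  shows "i \<in> Obj J \<Longrightarrow> fob F i \<in> Obj A"
    and "u \<in> Mor J \<Longrightarrow> fmor F u \<in> Mor A"
    and "u \<in> Mor J \<Longrightarrow> src A (fmor F u) = fob F (src J u)"
    and "u \<in> Mor J \<Longrightarrow> tgt A (fmor F u) = fob F (tgt J u)"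
    and "a \<in> Cel J \<Longrightarrow> fcel F a \<in> Cel A"
    and "a \<in> Cel J \<Longrightarrow> vsrc A (fcel F a) = fmor F (vsrc J a)"
    and "a \<in> Cel J \<Longrightarrow> vtgt A (fcel F a) = fmor F (vtgt J a)"
  using assms by (auto simp: is_two_functor_def is_functor_def und_cat_def vert_cat_def)

text \<open>Vertical and horizontal functoriality are equations between parallel cells of
  \<open>A\<close>, so \<open>thin\<close> settles them once the boundaries match.\<close>

lemma is_two_functorI:
  assumes und: "is_functor (und_cat J) (und_cat A) (fob F) (fmor F)"
    and cel: "\<And>a. a \<in> Cel J \<Longrightarrow> fcel F a \<in> Cel A \<and> vsrc A (fcel F a) = fmor F (vsrc J a)
      \<and> vtgt A (fcel F a) = fmor F (vtgt J a)"
    and ext: "fob F \<in> extensional (Obj J)" "fmor F \<in> extensional (Mor J)"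
      "fcel F \<in> extensional (Cel J)"
  shows "is_two_functor J A F"
proof -
  have o: "fob F i \<in> Obj A" "fmor F (one J i) = one A (fob F i)" if "i \<in> Obj J" for i
    using und that by (auto simp: is_functor_def und_cat_def)
  have m: "fmor F u \<in> Mor A" "src A (fmor F u) = fob F (src J u)"
    "tgt A (fmor F u) = fob F (tgt J u)" if "u \<in> Mor J" for u
    using und that by (auto simp: is_functor_def und_cat_def)
  have c: "fmor F (comp J v u) = comp A (fmor F v) (fmor F u)"
    if "u \<in> Mor J" "v \<in> Mor J" "src J v = tgt J u" for u v
    using und that by (auto simp: is_functor_def und_cat_def)
  have "is_functor (vert_cat J) (vert_cat A) (fmor F) (fcel F)"
    using J.vert A.vert by (auto simp: is_functor_def vert_cat_def cel m intro!: thin)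
  moreover have "is_functor (horz_cat J) (horz_cat A) (fob F) (fcel F)"
    using J.horz A.horz J.horz_laws
    by (auto simp: is_functor_def horz_cat_def cel m o c J.vsrc_hcomp J.vtgt_hcomp A.vsrc_hcomp
      A.vtgt_hcomp J.globular_src J.globular_tgt intro!: thin)
  ultimately show ?thesis
    using und ext J.two_category_axioms A.two_category_axioms by (simp add: is_two_functor_def)
qed

lemma two_natD:
  assumes "is_two_nat J A \<mu>"
  shows "is_two_functor J A (nsrc \<mu>)" and "is_two_functor J A (ntgt \<mu>)"
    and "i \<in> Obj J \<Longrightarrow> ncmp \<mu> i \<in> Mor A"
    and "i \<in> Obj J \<Longrightarrow> src A (ncmp \<mu> i) = fob (nsrc \<mu>) i"
    and "i \<in> Obj J \<Longrightarrow> tgt A (ncmp \<mu> i) = fob (ntgt \<mu>) i"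
    and "u \<in> Mor J \<Longrightarrow> comp A (fmor (ntgt \<mu>) u) (ncmp \<mu> (src J u))
      = comp A (ncmp \<mu> (tgt J u)) (fmor (nsrc \<mu>) u)"
    and "ncmp \<mu> \<in> extensional (Obj J)"
  using assms by (auto simp: is_two_nat_def)

text \<open>The two whiskerings in the 2-dimensional condition have equal boundaries by the
  1-dimensional naturality squares at \<open>vsrc J a\<close> and \<open>vtgt J a\<close>;
  \<open>thin\<close> does the rest.\<close>

lemma is_two_natI:
  assumes F: "is_two_functor J A (nsrc \<mu>)" and G: "is_two_functor J A (ntgt \<mu>)"
    and cmp: "\<And>i. i \<in> Obj J \<Longrightarrow> ncmp \<mu> i \<in> Mor A \<and> src A (ncmp \<mu> i) = fob (nsrc \<mu>) i
      \<and> tgt A (ncmp \<mu> i) = fob (ntgt \<mu>) i"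
    and nat: "\<And>u. u \<in> Mor J \<Longrightarrow> comp A (fmor (ntgt \<mu>) u) (ncmp \<mu> (src J u))
      = comp A (ncmp \<mu> (tgt J u)) (fmor (nsrc \<mu>) u)"
    and ext: "ncmp \<mu> \<in> extensional (Obj J)"
  shows "is_two_nat J A \<mu>"
proof -
  have "rwhisker A (fcel (ntgt \<mu>) a) (ncmp \<mu> (src J (vsrc J a)))
      = lwhisker A (ncmp \<mu> (tgt J (vsrc J a))) (fcel (nsrc \<mu>) a)" if "a \<in> Cel J" for a
    unfolding rwhisker_def lwhisker_def
    using that nat[of "vsrc J a"] nat[of "vtgt J a"]
    by (intro thin) (simp_all add: cmp two_functorD[OF F] two_functorD[OF G] A.vsrc_hcomp A.vtgt_hcomp
      J.globular_src J.globular_tgt)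
  then show ?thesis using assms by (simp add: is_two_nat_def)
qed

lemma two_nat_eqI:
  assumes "is_two_nat J A \<mu>" "is_two_nat J A \<nu>" "nsrc \<mu> = nsrc \<nu>" "ntgt \<mu> = ntgt \<nu>"
    and "\<And>i. i \<in> Obj J \<Longrightarrow> ncmp \<mu> i = ncmp \<nu> i"
  shows "\<mu> = \<nu>"
  using assms by (intro two_nat.equality extensionalityI[of _ "Obj J"]) (auto dest: two_natD)

text \<open>The whiskering equation follows from the boundary conditions: its sides are parallel
  because \<open>msrc \<phi>\<close> and \<open>mtgt \<phi>\<close> are both natural.\<close>

lemma is_modification_iff:
  "is_modification J A \<phi> \<longleftrightarrow> is_two_nat J A (msrc \<phi>) \<and> is_two_nat J A (mtgt \<phi>) \<and>
     nsrc (msrc \<phi>) = nsrc (mtgt \<phi>) \<and> ntgt (msrc \<phi>) = ntgt (mtgt \<phi>) \<and>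
     (\<forall>i\<in>Obj J. mcmp \<phi> i \<in> Cel A \<and> vsrc A (mcmp \<phi> i) = ncmp (msrc \<phi>) i
                 \<and> vtgt A (mcmp \<phi> i) = ncmp (mtgt \<phi>) i) \<and>
     mcmp \<phi> \<in> extensional (Obj J)" (is "_ \<longleftrightarrow> ?R")
proof -
  have "lwhisker A (fmor (ntgt (msrc \<phi>)) u) (mcmp \<phi> (src J u))
      = rwhisker A (mcmp \<phi> (tgt J u)) (fmor (nsrc (msrc \<phi>)) u)" if R: ?R and "u \<in> Mor J" for u
  proof -
    have n: "is_two_nat J A (msrc \<phi>)" "is_two_nat J A (mtgt \<phi>)" using R by auto
    have F: "is_two_functor J A (nsrc (mtgt \<phi>))" "is_two_functor J A (ntgt (mtgt \<phi>))"
      using two_natD[OF n(2)] by auto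
    show ?thesis
      unfolding rwhisker_def lwhisker_def
      using R \<open>u \<in> Mor J\<close> two_natD(6)[OF n(1), of u] two_natD(6)[OF n(2), of u]
      by (intro thin) (simp_all add: two_natD[OF n(1)] two_natD[OF n(2)] two_functorD[OF F(1)]
        two_functorD[OF F(2)] A.vsrc_hcomp A.vtgt_hcomp)
  qed
  then show ?thesis unfolding is_modification_def by blast
qed

text \<open>Thinness is inherited by the 2-category of 2-functors: \<open>thin\<close> fixes the
  components on objects, extensionality fixes them elsewhere.\<close>

lemma modification_eqI:
  assumes "is_modification J A \<phi>" "is_modification J A \<psi>" "msrc \<phi> = msrc \<psi>" "mtgt \<phi> = mtgt \<psi>"
  shows "\<phi> = \<psi>"
  using assms
  by (intro two_mod.equality extensionalityI[of _ "Obj J"])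
    (auto simp: is_modification_iff intro: thin)

text \<open>The naturality squares of \<open>\<nu>\<close> and \<open>\<mu>\<close> are pasted side
  by side.\<close>

lemma is_two_nat_comp:
  assumes m: "is_two_nat J A \<mu>" and n: "is_two_nat J A \<nu>" and e: "nsrc \<nu> = ntgt \<mu>"
  shows "is_two_nat J A (nat_comp J A \<nu> \<mu>)"
proof (rule is_two_natI)
  note M = two_natD[OF m] and N = two_natD[OF n]
  note F = two_functorD[OF M(1)] two_functorD[OF M(2)] two_functorD[OF N(2)]
  fix u assume u: "u \<in> Mor J"
  have "comp A (fmor (ntgt \<nu>) u) (comp A (ncmp \<nu> (src J u)) (ncmp \<mu> (src J u)))
    = comp A (comp A (fmor (ntgt \<nu>) u) (ncmp \<nu> (src J u))) (ncmp \<mu> (src J u))"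
    using u e by (simp add: M(1-5) N(1-5) F A.comp_assoc)
  also have "\<dots> = comp A (ncmp \<nu> (tgt J u)) (comp A (fmor (ntgt \<mu>) u) (ncmp \<mu> (src J u)))"
    using u e by (simp add: N(6)) (simp add: M(1-5) N(1-5) F A.comp_assoc)
  also have "\<dots> = comp A (comp A (ncmp \<nu> (tgt J u)) (ncmp \<mu> (tgt J u))) (fmor (nsrc \<mu>) u)"
    using u e by (simp add: M(6)) (simp add: M(1-5) N(1-5) F A.comp_assoc)
  finally show "comp A (fmor (ntgt (nat_comp J A \<nu> \<mu>)) u) (ncmp (nat_comp J A \<nu> \<mu>) (src J u))
      = comp A (ncmp (nat_comp J A \<nu> \<mu>) (tgt J u)) (fmor (nsrc (nat_comp J A \<nu> \<mu>)) u)"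
    using u by (simp add: nat_comp_def)
qed (use two_natD[OF m] two_natD[OF n] e in \<open>auto simp: nat_comp_def\<close>)

lemma nat_comp_assoc:
  assumes "is_two_nat J A \<mu>" "is_two_nat J A \<nu>" "is_two_nat J A \<xi>"
    "nsrc \<nu> = ntgt \<mu>" "nsrc \<xi> = ntgt \<nu>"
  shows "nat_comp J A (nat_comp J A \<xi> \<nu>) \<mu> = nat_comp J A \<xi> (nat_comp J A \<nu> \<mu>)"
  using two_natD[OF assms(1)] two_natD[OF assms(2)] two_natD[OF assms(3)] assms(4,5)
  by (auto simp: nat_comp_def A.comp_assoc intro!: restrict_ext)

lemma diag_ob_sel [simp]:
  "i \<in> Obj J \<Longrightarrow> fob (diag_ob J A x) i = x"
  "u \<in> Mor J \<Longrightarrow> fmor (diag_ob J A x) u = one A x"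
  "a \<in> Cel J \<Longrightarrow> fcel (diag_ob J A x) a = vone A (one A x)"
  by (simp_all add: diag_ob_def)

lemma is_two_functor_diag:
  assumes "x \<in> Obj A" shows "is_two_functor J A (diag_ob J A x)"
proof (rule is_two_functorI)
  have "comp A (one A x) (one A x) = one A x"
    using A.comp_one_left[of "one A x"] assms by simp
  then show "is_functor (und_cat J) (und_cat A) (fob (diag_ob J A x)) (fmor (diag_ob J A x))"
    using J.und A.und assms by (simp add: is_functor_def) (simp add: und_cat_def)
qed (use assms in \<open>auto simp: diag_ob_def\<close>)

lemma is_two_nat_diag: "f \<in> Mor A \<Longrightarrow> is_two_nat J A (diag_mor J A f)"
  by (intro is_two_natI)
    (auto simp: is_two_functor_diag diag_mor_def A.comp_one_left A.comp_one_right)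

lemma diag_mor_sel [simp]:
  "nsrc (diag_mor J A f) = diag_ob J A (src A f)" "ntgt (diag_mor J A f) = diag_ob J A (tgt A f)"
  "i \<in> Obj J \<Longrightarrow> ncmp (diag_mor J A f) i = f"
  by (simp_all add: diag_mor_def)

lemma nat_comp_sel [simp]:
  "nsrc (nat_comp J A \<nu> \<mu>) = nsrc \<mu>" "ntgt (nat_comp J A \<nu> \<mu>) = ntgt \<nu>"
  "i \<in> Obj J \<Longrightarrow> ncmp (nat_comp J A \<nu> \<mu>) i = comp A (ncmp \<nu> i) (ncmp \<mu> i)"
  by (simp_all add: nat_comp_def)

lemma nat_comp_diag:
  "\<lbrakk>f \<in> Mor A; g \<in> Mor A; src A g = tgt A f\<rbrakk>
    \<Longrightarrow> nat_comp J A (diag_mor J A g) (diag_mor J A f) = diag_mor J A (comp A g f)"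
  by (auto simp: nat_comp_def diag_mor_def)

lemma nat_comp_diag_one:
  assumes "is_two_nat J A \<mu>" "x \<in> Obj A" "nsrc \<mu> = diag_ob J A x"
  shows "nat_comp J A \<mu> (diag_mor J A (one A x)) = \<mu>"
proof (rule two_nat_eqI)
  fix i assume i: "i \<in> Obj J"
  then have "src A (ncmp \<mu> i) = x" using assms two_natD[OF assms(1)] by (simp add: diag_ob_def)
  then show "ncmp (nat_comp J A \<mu> (diag_mor J A (one A x))) i = ncmp \<mu> i"
    using i two_natD(3)[OF assms(1) i] A.comp_one_right[of "ncmp \<mu> i"] by simp
qed (use assms in \<open>simp_all add: is_two_nat_comp is_two_nat_diag\<close>)

lemma is_modification_diag: "a \<in> Cel A \<Longrightarrow> is_modification J A (diag_cel J A a)"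
  by (auto simp: is_modification_iff diag_cel_def is_two_nat_diag A.globular_src A.globular_tgt)

lemma is_modification_one: "is_two_nat J A \<mu> \<Longrightarrow> is_modification J A (mod_one J A \<mu>)"
  using two_natD[of \<mu>] by (auto simp: is_modification_iff mod_one_def)

lemma is_modification_vcomp:
  "\<lbrakk>is_modification J A \<phi>; is_modification J A \<psi>; msrc \<psi> = mtgt \<phi>\<rbrakk>
    \<Longrightarrow> is_modification J A (mod_vcomp J A \<psi> \<phi>)"
  by (auto simp: is_modification_iff mod_vcomp_def)

lemma is_modification_hcomp:
  assumes p: "is_modification J A \<phi>" and q: "is_modification J A \<psi>"
    and e: "nsrc (msrc \<psi>) = ntgt (msrc \<phi>)"
  shows "is_modification J A (mod_hcomp J A \<psi> \<phi>)"
proof -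
  have n: "is_two_nat J A (msrc \<phi>)" "is_two_nat J A (mtgt \<phi>)" "is_two_nat J A (msrc \<psi>)"
    "is_two_nat J A (mtgt \<psi>)" using p q by (auto simp: is_modification_iff)
  show ?thesis
    using p q e two_natD[OF n(1)] two_natD[OF n(3)] unfolding is_modification_iff
    by (auto simp: mod_hcomp_def intro!: is_two_nat_comp A.vsrc_hcomp[THEN trans] A.vtgt_hcomp[THEN trans])
qed

lemma modificationD:
  assumes "is_modification J A \<phi>"
  shows "is_two_nat J A (msrc \<phi>)" "is_two_nat J A (mtgt \<phi>)"
    "nsrc (mtgt \<phi>) = nsrc (msrc \<phi>)" "ntgt (mtgt \<phi>) = ntgt (msrc \<phi>)"
  using assms by (auto simp: is_modification_iff)

lemma modification_sel [simp]:
  "msrc (mod_one J A \<mu>) = \<mu>" "mtgt (mod_one J A \<mu>) = \<mu>"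
  "msrc (mod_vcomp J A \<psi> \<phi>) = msrc \<phi>" "mtgt (mod_vcomp J A \<psi> \<phi>) = mtgt \<psi>"
  "msrc (mod_hcomp J A \<psi> \<phi>) = nat_comp J A (msrc \<psi>) (msrc \<phi>)"
  "mtgt (mod_hcomp J A \<psi> \<phi>) = nat_comp J A (mtgt \<psi>) (mtgt \<phi>)"
  "msrc (diag_cel J A a) = diag_mor J A (vsrc A a)"
  "mtgt (diag_cel J A a) = diag_mor J A (vtgt A a)"
  by (simp_all add: mod_one_def mod_vcomp_def mod_hcomp_def diag_cel_def)

lemma category_hom_fun_two_cat: "category (hom_cat (fun_two_cat J A) F G)"
proof
qed (auto simp: hom_cat_def fun_two_cat_def is_modification_one is_modification_vcomp modificationD
    intro: modification_eqI)

lemma fun_two_cat_sel [simp]: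
  "src (fun_two_cat J A) = nsrc" "tgt (fun_two_cat J A) = ntgt"
  "one (fun_two_cat J A) = nat_one J A" "comp (fun_two_cat J A) = nat_comp J A"
  "vsrc (fun_two_cat J A) = msrc" "vtgt (fun_two_cat J A) = mtgt"
  "vone (fun_two_cat J A) = mod_one J A" "vcomp (fun_two_cat J A) = mod_vcomp J A"
  "hcomp (fun_two_cat J A) = mod_hcomp J A"
  "lwhisker (fun_two_cat J A) \<nu> \<phi> = mod_hcomp J A (mod_one J A \<nu>) \<phi>"
  "rwhisker (fun_two_cat J A) \<phi> \<mu> = mod_hcomp J A \<phi> (mod_one J A \<mu>)"
  by (simp_all add: fun_two_cat_def lwhisker_def rwhisker_def)

section \<open>The lax slice over a locally thin target\<close>

lemma is_two_coneD:
  assumes "is_two_cone J A F x \<mu>"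
  shows "x \<in> Obj A" "is_two_nat J A \<mu>" "nsrc \<mu> = diag_ob J A x" "ntgt \<mu> = F"
  using assms by (auto simp: is_two_cone_def)

lemma is_lax_morD:
  assumes "is_lax_mor J A F p"
  shows "is_two_cone J A F (fst (lsrc p)) (snd (lsrc p))"
    "is_two_cone J A F (fst (ltgt p)) (snd (ltgt p))"
    "lmor p \<in> Mor A" "src A (lmor p) = fst (lsrc p)" "tgt A (lmor p) = fst (ltgt p)"
    "is_modification J A (lmod p)"
    "msrc (lmod p) = nat_comp J A (snd (ltgt p)) (diag_mor J A (lmor p))"
    "mtgt (lmod p) = snd (lsrc p)"
  using assms by (auto simp: is_lax_mor_def)

text \<open>The two cones and the underlying morphism fix the boundary of the modification, and thus
  the modification itself.\<close>

lemma lax_mor_eqI: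
  assumes "is_lax_mor J A F p" "is_lax_mor J A F q"
    and "lsrc p = lsrc q" "ltgt p = ltgt q" "lmor p = lmor q"
  shows "p = q"
  using assms by (intro lax_mor.equality modification_eqI) (auto simp: is_lax_morD)

text \<open>The condition \<psi>(\<nu> * \<Delta>\<alpha>) = \<phi> compares parallel modifications,
  so it holds automatically.\<close>

lemma is_lax_cel_iff:
  "is_lax_cel J A F a \<longleftrightarrow>
     is_lax_mor J A F (lvsrc a) \<and> is_lax_mor J A F (lvtgt a) \<and>
     lsrc (lvsrc a) = lsrc (lvtgt a) \<and> ltgt (lvsrc a) = ltgt (lvtgt a) \<and>
     lcel a \<in> Cel A \<and> vsrc A (lcel a) = lmor (lvsrc a) \<and> vtgt A (lcel a) = lmor (lvtgt a)"
    (is "_ \<longleftrightarrow> ?R")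
proof -
  have "mod_vcomp J A (lmod (lvtgt a))
      (mod_hcomp J A (mod_one J A (snd (ltgt (lvsrc a)))) (diag_cel J A (lcel a))) = lmod (lvsrc a)"
    if R: ?R
  proof -
    have p: "is_lax_mor J A F (lvsrc a)" and q: "is_lax_mor J A F (lvtgt a)" using R by auto
    note P = is_lax_morD[OF p] and Q = is_lax_morD[OF q]
    have "is_modification J A (mod_hcomp J A (mod_one J A (snd (ltgt (lvsrc a)))) (diag_cel J A (lcel a)))"
      using R P Q is_two_coneD[OF P(2)]
      by (intro is_modification_hcomp is_modification_diag is_modification_one) simp_all
    then show ?thesis
      using R P Q by (intro modification_eqI is_modification_vcomp) simp_all
  qed
  then show ?thesis unfolding is_lax_cel_def by auto
qed

lemma lax_cel_eqI:
  assumes "is_lax_cel J A F a" "is_lax_cel J A F b" "lvsrc a = lvsrc b" "lvtgt a = lvtgt b"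
  shows "a = b"
  using assms by (intro lax_cel.equality thin) (auto simp: is_lax_cel_iff)

lemma lax_one_sel [simp]:
  "lsrc (lax_one J A z) = z" "ltgt (lax_one J A z) = z" "lmor (lax_one J A z) = one A (fst z)"
  by (simp_all add: lax_one_def)

lemma lax_comp_sel [simp]:
  "lsrc (lax_comp J A q p) = lsrc p" "ltgt (lax_comp J A q p) = ltgt q"
  "lmor (lax_comp J A q p) = comp A (lmor q) (lmor p)"
  by (simp_all add: lax_comp_def)

lemma is_lax_mor_one:
  assumes "is_two_cone J A F (fst z) (snd z)" shows "is_lax_mor J A F (lax_one J A z)"
  using is_two_coneD[OF assms] assms
  by (simp add: is_lax_mor_def) (simp add: lax_one_def is_modification_one nat_comp_diag_one)

lemma is_lax_mor_comp:
  assumes p: "is_lax_mor J A F p" and q: "is_lax_mor J A F q" and e: "lsrc q = ltgt p"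
  shows "is_lax_mor J A F (lax_comp J A q p)"
proof -
  note P = is_lax_morD[OF p] and Q = is_lax_morD[OF q]
  note C = is_two_coneD[OF P(1)] is_two_coneD[OF P(2)] is_two_coneD[OF Q(2)]
  have "is_modification J A (mod_hcomp J A (lmod q) (mod_one J A (diag_mor J A (lmor p))))"
    using P Q e by (intro is_modification_hcomp is_modification_one is_two_nat_diag) simp_all
  \<comment> \<open>The pasting starts at the cone bracketed as (\<xi> \<Delta>g) \<Delta>f, whereas
    a lax morphism over gf must start at \<xi> \<Delta>(gf).\<close>
  moreover have "nat_comp J A (snd (ltgt q)) (diag_mor J A (comp A (lmor q) (lmor p))) =
      nat_comp J A (nat_comp J A (snd (ltgt q)) (diag_mor J A (lmor q))) (diag_mor J A (lmor p))"
    using P(3-5) Q(3-5) C e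
    by (subst nat_comp_assoc) (simp_all add: is_two_nat_diag nat_comp_diag)
  ultimately show ?thesis
    using P Q e
    by (simp add: is_lax_mor_def) (simp add: lax_comp_def is_modification_vcomp)
qed

lemma lax_comp_one_right:
  assumes "is_lax_mor J A F p" shows "lax_comp J A p (lax_one J A (lsrc p)) = p"
  using assms is_lax_morD[OF assms] A.comp_one_right[OF is_lax_morD(3)[OF assms]]
  by (intro lax_mor_eqI is_lax_mor_comp is_lax_mor_one) simp_all

lemma lax_comp_one_left:
  assumes "is_lax_mor J A F p" shows "lax_comp J A (lax_one J A (ltgt p)) p = p"
  using assms is_lax_morD[OF assms] A.comp_one_left[OF is_lax_morD(3)[OF assms]]
  by (intro lax_mor_eqI is_lax_mor_comp is_lax_mor_one) simp_all

lemma lax_comp_assoc: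
  assumes "is_lax_mor J A F p" "is_lax_mor J A F q" "is_lax_mor J A F r"
    and "lsrc q = ltgt p" "lsrc r = ltgt q"
  shows "lax_comp J A (lax_comp J A r q) p = lax_comp J A r (lax_comp J A q p)"
  using assms is_lax_morD[OF assms(1)] is_lax_morD[OF assms(2)] is_lax_morD[OF assms(3)]
  by (intro lax_mor_eqI is_lax_mor_comp) (simp_all add: A.comp_assoc)

lemma is_lax_cel_one:
  "is_lax_mor J A F p \<Longrightarrow> is_lax_cel J A F \<lparr>lvsrc = p, lvtgt = p, lcel = vone A (lmor p)\<rparr>"
  by (simp add: is_lax_cel_iff is_lax_morD)

lemma is_lax_cel_hcomp:
  assumes a: "is_lax_cel J A F a" and b: "is_lax_cel J A F b"
    and e: "lsrc (lvsrc b) = ltgt (lvsrc a)"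
  shows "is_lax_cel J A F \<lparr>lvsrc = lax_comp J A (lvsrc b) (lvsrc a),
      lvtgt = lax_comp J A (lvtgt b) (lvtgt a), lcel = hcomp A (lcel b) (lcel a)\<rparr>"
proof -
  have m: "is_lax_mor J A F (lvsrc a)" "is_lax_mor J A F (lvtgt a)" "is_lax_mor J A F (lvsrc b)"
    "is_lax_mor J A F (lvtgt b)" using a b by (auto simp: is_lax_cel_iff)
  have "src A (vsrc A (lcel b)) = tgt A (vsrc A (lcel a))"
    using a b e by (simp add: is_lax_cel_iff is_lax_morD(4)[OF m(3)] is_lax_morD(5)[OF m(1)])
  then show ?thesis
    using a b e by (simp add: is_lax_cel_iff is_lax_mor_comp A.vsrc_hcomp A.vtgt_hcomp)
qed

lemma lax_celD:
  assumes "is_lax_cel J A F a"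
  shows "is_lax_mor J A F (lvsrc a)" "is_lax_mor J A F (lvtgt a)"
    "lsrc (lvtgt a) = lsrc (lvsrc a)" "ltgt (lvtgt a) = ltgt (lvsrc a)" "lcel a \<in> Cel A"
    "vsrc A (lcel a) = lmor (lvsrc a)" "vtgt A (lcel a) = lmor (lvtgt a)"
    "src A (lmor (lvsrc a)) = fst (lsrc (lvsrc a))" "tgt A (lmor (lvsrc a)) = fst (ltgt (lvsrc a))"
  using assms by (auto simp: is_lax_cel_iff dest: is_lax_morD)

text \<open>Laws for morphisms come down to those of \<open>A\<close> through
  \<open>lax_mor_eqI\<close>, and laws for cells follow once their recorded boundaries
  agree.\<close>

lemma two_category_lax_slice: "two_category (lax_slice J A F)" (is "two_category ?S")
proof (rule two_category.intro)
  show "category (und_cat ?S)"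
    by unfold_locales
      (auto simp: und_cat_def lax_slice_def is_lax_morD is_lax_mor_one is_lax_mor_comp
        lax_comp_one_right lax_comp_one_left lax_comp_assoc)
  show "category (vert_cat ?S)"
    by unfold_locales
      (auto simp: vert_cat_def lax_slice_def is_lax_cel_iff is_lax_morD(3) A.vert_laws
        intro!: lax_cel.equality thin)
  show "category (horz_cat ?S)"
  proof
    fix a assume "a \<in> Ar (horz_cat ?S)"
    then have a: "is_lax_cel J A F a" by (simp add: horz_cat_def lax_slice_def)
    note D = lax_celD[OF a]
    note id = is_lax_cel_one[OF is_lax_mor_one]
    let ?x = "lsrc (lvsrc a)" and ?y = "ltgt (lvsrc a)"
    \<comment> \<open>Cells record their full source and target, so the unit laws are needed for
      both boundary morphisms before any cells can be compared.\<close>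
    have x: "lax_comp J A (lvsrc a) (lax_one J A ?x) = lvsrc a"
      "lax_comp J A (lvtgt a) (lax_one J A ?x) = lvtgt a"
      "lax_comp J A (lax_one J A ?y) (lvsrc a) = lvsrc a"
      "lax_comp J A (lax_one J A ?y) (lvtgt a) = lvtgt a"
      using D(1-4) lax_comp_one_right[of F "lvsrc a"] lax_comp_one_right[of F "lvtgt a"]
        lax_comp_one_left[of F "lvsrc a"] lax_comp_one_left[of F "lvtgt a"] by simp_all
    have "\<lparr>lvsrc = lvsrc a, lvtgt = lvtgt a,
        lcel = hcomp A (lcel a) (vone A (one A (fst ?x)))\<rparr> = a"
      using is_lax_cel_hcomp[OF id[OF is_lax_morD(1)[OF D(1)]] a]
      by (intro lax_cel_eqI[OF _ a]) (simp_all add: x)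
    then show "Cmp (horz_cat ?S) a (Idn (horz_cat ?S) (Dom (horz_cat ?S) a)) = a"
      by (simp add: horz_cat_def lax_slice_def x)
    have "\<lparr>lvsrc = lvsrc a, lvtgt = lvtgt a,
        lcel = hcomp A (vone A (one A (fst ?y))) (lcel a)\<rparr> = a"
      using is_lax_cel_hcomp[OF a id[OF is_lax_morD(2)[OF D(1)]]]
      by (intro lax_cel_eqI[OF _ a]) (simp_all add: x)
    then show "Cmp (horz_cat ?S) (Idn (horz_cat ?S) (Cod (horz_cat ?S) a)) a = a"
      by (simp add: horz_cat_def lax_slice_def x)
  qed (auto simp: horz_cat_def lax_slice_def lax_celD is_lax_morD is_lax_cel_hcomp
      is_lax_cel_one[OF is_lax_mor_one, simplified] lax_comp_assoc[of F] A.horz_laws)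
next
  fix a a' b b'
  assume "a \<in> Cel ?S" "a' \<in> Cel ?S" "b \<in> Cel ?S" "b' \<in> Cel ?S"
    "vsrc ?S a' = vtgt ?S a" "vsrc ?S b' = vtgt ?S b"
    "src ?S (vsrc ?S b) = tgt ?S (vsrc ?S a)"
  then show "hcomp ?S (vcomp ?S b' b) (vcomp ?S a' a) = vcomp ?S (hcomp ?S b' a') (hcomp ?S b a)"
    by (simp add: lax_slice_def lax_celD A.interchange)
qed (auto simp: lax_slice_def lax_celD is_lax_morD A.hcomp_vone)

end

section \<open>Normal forms in the example\<close>

text \<open>In the \<open>MComp\<close> clause both factors carry a tag only for ill-formed terms: a
  tagged term starts at X and ends elsewhere.\<close>

fun mtag :: "('o, ex_mor) mterm \<Rightarrow> ex_mor option" where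
  "mtag (MId x) = None"
| "mtag (MGen m) = (if m = mor_f \<or> m = mor_g then Some m else None)"
| "mtag (MComp g f) = (if mtag f = None then mtag g else mtag f)"

text \<open>For \<open>y \<noteq> obX\<close> this represents the only morphism from L to
  \<open>y\<close>; at \<open>obA\<close> one side of the relation is chosen. The value at
  \<open>obX\<close> is a default.\<close>

fun canon_post :: "ex_ob \<Rightarrow> (ex_ob, ex_mor) mterm" where
  "canon_post obB = MGen mor_l0"
| "canon_post obC = MGen mor_l1"
| "canon_post obA = MComp (MGen mor_b) (MGen mor_l0)"
| "canon_post x = MId x"

text \<open>Only meaningful for admissible arguments; the remaining values are junk.\<close>

fun canon :: "ex_ob \<Rightarrow> ex_ob \<Rightarrow> ex_mor option \<Rightarrow> (ex_ob, ex_mor) mterm" where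
  "canon x y (Some m) = MComp (canon_post y) (MGen m)"
| "canon x y None = (if x = y then MId x else if x = obL then canon_post y
     else if x = obB then MGen mor_b else MGen mor_c)"

text \<open>These are exactly the triples realized by well-formed terms:
  \<open>admissible_mwf\<close> gives one direction, \<open>mwf_canon\<close> the other.\<close>

definition admissible :: "ex_ob \<Rightarrow> ex_ob \<Rightarrow> ex_mor option \<Rightarrow> bool" where
  "admissible x y t \<longleftrightarrow>
     (case t of None \<Rightarrow> x = y \<or> x = obL \<and> y \<noteq> obX \<or> (x = obB \<or> x = obC) \<and> y = obA
      | Some m \<Rightarrow> (m = mor_f \<or> m = mor_g) \<and> x = obX \<and> y \<noteq> obX)"

lemma ex_pres_sel [simp]:
  "gob ex_pres = UNIV" "gmor ex_pres = UNIV" "gsrc ex_pres = ex_src" "gtgt ex_pres = ex_tgt"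
  "gcel ex_pres = UNIV" "gvsrc ex_pres a = MGen mor_f" "gvtgt ex_pres a = MGen mor_g"
  "mrel ex_pres = {(MComp (MGen mor_b) (MGen mor_l0), MComp (MGen mor_c) (MGen mor_l1))}"
  "crel ex_pres = {}"
  by (simp_all add: ex_pres_def)

abbreviation (input) "ex_meq \<equiv> meq ex_pres"
abbreviation (input) "ex_ceq \<equiv> ceq ex_pres"

declare meq.meq_trans [trans] ceq.ceq_trans [trans]

lemmas ex_meq_parallel = meq_parallel[OF wf_presentation_ex_pres]
  and ex_cwf_boundary = cwf_boundary[OF wf_presentation_ex_pres]

text \<open>Tags compose by keeping the first one met, an associative operation with unit
  \<open>None\<close>, and both sides of the relation have tag \<open>None\<close>. This invariant
  is what separates f from g.\<close>

lemma meq_imp_mtag_eq: "ex_meq f g \<Longrightarrow> mtag f = mtag g"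
  by (induction rule: meq.induct) auto

lemma admissible_mwf:
  "mwf ex_pres f \<Longrightarrow> admissible (msource ex_pres f) (mtarget ex_pres f) (mtag f)"
proof (induction f)
  case (MGen m)
  then show ?case by (cases m) (auto simp: admissible_def)
qed (auto simp: admissible_def split: option.splits if_splits)

lemma mwf_canon:
  "admissible x y t \<Longrightarrow> mwf ex_pres (canon x y t) \<and> msource ex_pres (canon x y t) = x \<and>
     mtarget ex_pres (canon x y t) = y \<and> mtag (canon x y t) = t"
  by (cases y; cases x; auto simp: admissible_def split: option.splits)

lemma mwf_canon_post [simp]:
  "y \<noteq> obX \<Longrightarrow> mwf ex_pres (canon_post y)" "y \<noteq> obX \<Longrightarrow> msource ex_pres (canon_post y) = obL"
  "mtarget ex_pres (canon_post y) = y" "mtag (canon_post y) = None"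
  by (cases y; simp)+

lemma meq_canon_comp:
  assumes "admissible x y t" "admissible y z u"
  shows "ex_meq (MComp (canon y z u) (canon x y t)) (canon x z (if t = None then u else t))"
proof -
  \<comment> \<open>Besides composites with an identity, only three shapes remain: f or g followed
    by a path from L, and paths from X or from L that reach A through B or C.\<close>
  consider (id1) "x = y" "t = None" | (id2) "y = z" "u = None"
    | (fg) m where "x = obX" "t = Some m" "y = obL" "u = None" "z \<noteq> obL"
    | (post) m where "x = obX" "t = Some m" "y = obB \<or> y = obC" "u = None" "z = obA"
    | (lim) "x = obL" "t = None" "y = obB \<or> y = obC" "u = None" "z = obA"
    using assms by (cases x; cases y; cases z) (auto simp: admissible_def split: option.splits)
  then show ?thesis
  proof cases
    case id1
    then show ?thesis
      using meq.meq_unit_right[of ex_pres "canon y z u"] mwf_canon[OF assms(2)] by simp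
  next
    case id2
    then show ?thesis
      using meq.meq_unit_left[of ex_pres "canon x y t"] mwf_canon[OF assms(1)] by auto
  next
    case fg
    \<comment> \<open>The normal form of f and g contains the identity
      \<open>canon_post obL\<close>, which has to be absorbed.\<close>
    have "ex_meq (MComp (MId (mtarget ex_pres (MGen m))) (MGen m)) (MGen m)"
      by (rule meq.meq_unit_left) simp
    then have "ex_meq (MComp (canon_post z) (MComp (MId obL) (MGen m))) (MComp (canon_post z) (MGen m))"
      using fg assms by (intro meq.meq_comp meq.meq_refl) (auto simp: admissible_def)
    then show ?thesis using fg by simp
  next
    case post
    have rel: "ex_meq (MComp (MGen mor_c) (MGen mor_l1)) (MComp (MGen mor_b) (MGen mor_l0))"
      by (intro meq.meq_sym[OF meq.meq_rel]) simp
    have m: "ex_tgt m = obL" using post assms by (auto simp: admissible_def)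
    let ?p = "canon y z u"
    \<comment> \<open>For \<open>y = obC\<close> this is the defining relation, for
      \<open>y = obB\<close> it is reflexivity.\<close>
    have r: "ex_meq (MComp ?p (canon_post y)) (MComp (MGen mor_b) (MGen mor_l0))"
      using post rel by (auto intro: meq.meq_refl)
    have "ex_meq (MComp ?p (MComp (canon_post y) (MGen m))) (MComp (MComp ?p (canon_post y)) (MGen m))"
      using post m by (intro meq.meq_sym[OF meq.meq_assoc]) auto
    also have "ex_meq (MComp (MComp ?p (canon_post y)) (MGen m))
        (MComp (MComp (MGen mor_b) (MGen mor_l0)) (MGen m))"
      using post m by (intro meq.meq_comp[OF r meq.meq_refl]) auto
    finally show ?thesis using post by simp
  next
    case lim
    then show ?thesis using meq.meq_rel[of "MComp (MGen mor_b) (MGen mor_l0)"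
      "MComp (MGen mor_c) (MGen mor_l1)" ex_pres] by (auto intro: meq.meq_sym meq.meq_refl)
  qed
qed

lemma meq_canon: "mwf ex_pres f \<Longrightarrow> ex_meq f (canon (msource ex_pres f) (mtarget ex_pres f) (mtag f))"
proof (induction f)
  case (MId x)
  then show ?case by (simp add: meq.meq_refl)
next
  case (MGen m)
  then show ?case
  proof (cases "mtag (MGen m :: (ex_ob, ex_mor) mterm)")
    case None
    then show ?thesis by (cases m) (auto simp: meq.meq_refl)
  next
    case (Some n)
    then have m: "m = mor_f \<or> m = mor_g" by (simp split: if_splits)
    then have "ex_meq (MComp (MId (mtarget ex_pres (MGen m))) (MGen m)) (MGen m)"
      by (intro meq.meq_unit_left) simp
    with m show ?thesis by (auto intro: meq.meq_sym)
  qed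
next
  case (MComp g f)
  let ?s = "msource ex_pres f" and ?m = "mtarget ex_pres f" and ?t = "mtarget ex_pres g"
  have a: "admissible ?s ?m (mtag f)" "admissible ?m ?t (mtag g)"
    using admissible_mwf[of f] admissible_mwf[of g] MComp.prems by simp_all
  have "ex_meq (MComp g f) (MComp (canon ?m ?t (mtag g)) (canon ?s ?m (mtag f)))"
    using MComp by (intro meq.meq_comp) simp_all
  then show ?case using meq_canon_comp[OF a] by (auto intro: meq.meq_trans)
qed

text \<open>Terms with equal invariants share their normal form, so these invariants solve the word
  problem for morphisms.\<close>

lemma ex_meq_iff:
  assumes "mwf ex_pres f" "mwf ex_pres g"
  shows "ex_meq f g \<longleftrightarrow> msource ex_pres f = msource ex_pres g \<and>
    mtarget ex_pres f = mtarget ex_pres g \<and> mtag f = mtag g"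
  using meq_canon[OF assms(1)] meq_canon[OF assms(2)] ex_meq_parallel meq_imp_mtag_eq
  by (metis meq.meq_sym meq.meq_trans)

section \<open>Normal forms of 2-cells\<close>

abbreviation (input) "alpha_post y \<equiv> HComp (CId (canon_post y)) (CGen cel_alpha)"

text \<open>At most one factor of any composite can be a whiskering of \<alpha>; the other is an
  identity cell and is absorbed. The tags of the two boundaries tell the alternatives apart.\<close>

lemma ceq_CId_or_alpha:
  assumes "cwf ex_pres a"
  shows "ex_meq (csource ex_pres a) (ctarget ex_pres a) \<and> ex_ceq a (CId (csource ex_pres a)) \<or>
     mtag (csource ex_pres a) = Some mor_f \<and> mtag (ctarget ex_pres a) = Some mor_g \<and>
     msource ex_pres (csource ex_pres a) = obX \<and> mtarget ex_pres (csource ex_pres a) \<noteq> obX \<and>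
     ex_ceq a (alpha_post (mtarget ex_pres (csource ex_pres a)))"
  using assms
proof (induction a)
  case (CId f)
  then show ?case by (simp add: ceq.ceq_refl meq.meq_refl)
next
  case (CGen x)
  have "ex_ceq (HComp (CId (MId (mtarget ex_pres (csource ex_pres (CGen x))))) (CGen x)) (CGen x)"
    by (rule ceq.ceq_hunit_left) simp
  then show ?case by (cases x) (auto intro: ceq.ceq_sym)
next
  case (VComp b a)
  then have w: "cwf ex_pres b" "cwf ex_pres a" and e: "ex_meq (csource ex_pres b) (ctarget ex_pres a)"
    by auto
  note t = meq_imp_mtag_eq[OF e] and p = ex_meq_parallel[OF e]
    and ba = ex_cwf_boundary[OF w(2)] and bb = ex_cwf_boundary[OF w(1)]
  consider (id) "ex_meq (csource ex_pres b) (ctarget ex_pres b)" "ex_ceq b (CId (csource ex_pres b))"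
    | (alpha) "mtag (csource ex_pres b) = Some mor_f" "mtag (ctarget ex_pres b) = Some mor_g"
        "msource ex_pres (csource ex_pres b) = obX" "mtarget ex_pres (csource ex_pres b) \<noteq> obX"
        "ex_ceq b (alpha_post (mtarget ex_pres (csource ex_pres b)))"
    using VComp.IH(1)[OF w(1)] by blast
  then show ?case
  proof cases
    case id
    have "ex_ceq (VComp b a) (VComp (CId (ctarget ex_pres a)) a)"
      using id(2) e w by (intro ceq.ceq_vcomp) (auto intro: ceq.ceq_trans ceq.ceq_id ceq.ceq_refl)
    then have "ex_ceq (VComp b a) a" using ceq.ceq_vunit_left[OF w(2)] ceq.ceq_trans by blast
    moreover have "ex_meq (ctarget ex_pres a) (ctarget ex_pres b)"
      using e id(1) by (blast intro: meq.meq_sym meq.meq_trans)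
    ultimately show ?thesis
      using VComp.IH(2)[OF w(2)] meq_imp_mtag_eq
      by (auto intro: meq.meq_trans ceq.ceq_trans)
  next
    case alpha
    \<comment> \<open>A second copy of \<alpha> below would make this tag
      \<open>Some mor_g\<close>.\<close>
    then have "mtag (ctarget ex_pres a) = Some mor_f" using t by simp
    then have a: "ex_meq (csource ex_pres a) (ctarget ex_pres a)" "ex_ceq a (CId (csource ex_pres a))"
      using VComp.IH(2)[OF w(2)] by auto
    have "ex_meq (csource ex_pres a) (csource ex_pres b)"
      using e a(1) by (blast intro: meq.meq_sym meq.meq_trans)
    then have "ex_ceq (VComp b a) (VComp b (CId (csource ex_pres b)))"
      using a(2) e w by (intro ceq.ceq_vcomp) (auto intro: ceq.ceq_trans ceq.ceq_id ceq.ceq_refl)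
    then have "ex_ceq (VComp b a) b" using ceq.ceq_vunit_right[OF w(1)] ceq.ceq_trans by blast
    then show ?thesis
      using alpha p ba meq_imp_mtag_eq[OF a(1)] t by (auto intro: ceq.ceq_trans)
  qed
next
  case (HComp b a)
  then have w: "cwf ex_pres b" "cwf ex_pres a"
    and e: "msource ex_pres (csource ex_pres b) = mtarget ex_pres (csource ex_pres a)"
    by auto
  note ba = ex_cwf_boundary[OF w(2)] and bb = ex_cwf_boundary[OF w(1)]
  \<comment> \<open>Two copies of \<alpha> are excluded by \<open>e\<close>: the left one would
    start at X, while the right one ends elsewhere.\<close>
  consider (id) "ex_meq (csource ex_pres b) (ctarget ex_pres b)" "ex_ceq b (CId (csource ex_pres b))"
      "ex_meq (csource ex_pres a) (ctarget ex_pres a)" "ex_ceq a (CId (csource ex_pres a))"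
    | (post) "ex_meq (csource ex_pres b) (ctarget ex_pres b)" "ex_ceq b (CId (csource ex_pres b))"
        "mtag (csource ex_pres a) = Some mor_f" "mtag (ctarget ex_pres a) = Some mor_g"
        "msource ex_pres (csource ex_pres a) = obX" "mtarget ex_pres (csource ex_pres a) \<noteq> obX"
        "ex_ceq a (alpha_post (mtarget ex_pres (csource ex_pres a)))"
    | (pre) "mtag (csource ex_pres b) = Some mor_f" "mtag (ctarget ex_pres b) = Some mor_g"
        "msource ex_pres (csource ex_pres b) = obX" "mtarget ex_pres (csource ex_pres b) \<noteq> obX"
        "ex_ceq b (alpha_post (mtarget ex_pres (csource ex_pres b)))"
        "ex_meq (csource ex_pres a) (ctarget ex_pres a)" "ex_ceq a (CId (csource ex_pres a))"
    using HComp.IH(1)[OF w(1)] HComp.IH(2)[OF w(2)] e by metis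
  then show ?case
  proof cases
    case id
    have "ex_ceq (HComp b a) (HComp (CId (csource ex_pres b)) (CId (csource ex_pres a)))"
      using id e by (intro ceq.ceq_hcomp) auto
    then have "ex_ceq (HComp b a) (CId (MComp (csource ex_pres b) (csource ex_pres a)))"
      using ceq.ceq_hid[of ex_pres] e ba bb ceq.ceq_trans by blast
    then show ?thesis using id e by (auto intro: meq.meq_comp)
  next
    case post
    let ?y = "mtarget ex_pres (csource ex_pres a)" and ?z = "mtarget ex_pres (csource ex_pres b)"
    \<comment> \<open>Since \<open>?y\<close> is not X, the left factor has tag \<open>None\<close>.
      Following \<open>canon_post ?y\<close> by it therefore gives a morphism from L with the
      invariants of \<open>canon_post ?z\<close>.\<close>
    have ad: "admissible ?y ?z (mtag (csource ex_pres b))"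
      using admissible_mwf[of "csource ex_pres b"] bb e by simp
    then have tb: "mtag (csource ex_pres b) = None" and z: "?z \<noteq> obX"
      using post(6) by (auto simp: admissible_def split: option.splits)
    have "ex_ceq (HComp b a) (HComp (CId (csource ex_pres b)) (alpha_post ?y))"
      using post e by (intro ceq.ceq_hcomp) auto
    also have "ex_ceq \<dots> (HComp (HComp (CId (csource ex_pres b)) (CId (canon_post ?y))) (CGen cel_alpha))"
      using post e bb by (intro ceq.ceq_sym[OF ceq.ceq_hassoc]) auto
    also have "ex_ceq \<dots> (HComp (CId (MComp (csource ex_pres b) (canon_post ?y))) (CGen cel_alpha))"
      using post e bb by (intro ceq.ceq_hcomp ceq.ceq_hid ceq.ceq_refl) auto
    also have "ex_ceq \<dots> (alpha_post ?z)"
      using post e bb z tb by (intro ceq.ceq_hcomp ceq.ceq_id ceq.ceq_refl) (auto simp: ex_meq_iff)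
    finally show ?thesis using post z by simp
  next
    case pre
    \<comment> \<open>Here the right factor ends at X, and the only morphism into X is its
      identity.\<close>
    have "admissible (msource ex_pres (csource ex_pres a)) obX (mtag (csource ex_pres a))"
      using admissible_mwf[of "csource ex_pres a"] ba e pre(3) by simp
    then have "msource ex_pres (csource ex_pres a) = obX" and ta: "mtag (csource ex_pres a) = None"
      by (auto simp: admissible_def split: option.splits)
    then have "ex_meq (csource ex_pres a) (MId (msource ex_pres (csource ex_pres b)))"
      using ba e pre(3) by (simp add: ex_meq_iff)
    then have "ex_ceq (HComp b a) (HComp b (CId (MId (msource ex_pres (csource ex_pres b)))))"
      using pre(7) w e by (intro ceq.ceq_hcomp) (auto intro: ceq.ceq_trans ceq.ceq_id ceq.ceq_refl)
    then have "ex_ceq (HComp b a) b" using ceq.ceq_hunit_right[OF w(1)] ceq.ceq_trans by blast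
    then show ?thesis
      using pre ta \<open>msource ex_pres (csource ex_pres a) = obX\<close> meq_imp_mtag_eq[OF pre(6)]
      by (auto intro: ceq.ceq_trans)
  qed
qed

text \<open>Equal boundary tags put both cells in the same alternative, and either normal form
  depends on the boundary alone. This is local thinness of the example.\<close>

lemma ceq_if_parallel:
  assumes w: "cwf ex_pres a" "cwf ex_pres b" and s: "ex_meq (csource ex_pres a) (csource ex_pres b)"
    and t: "ex_meq (ctarget ex_pres a) (ctarget ex_pres b)"
  shows "ex_ceq a b"
proof -
  have e: "mtag (csource ex_pres a) = mtag (csource ex_pres b)"
    "mtag (ctarget ex_pres a) = mtag (ctarget ex_pres b)"
    using s t meq_imp_mtag_eq by auto
  consider "ex_ceq a (CId (csource ex_pres a))" "ex_ceq b (CId (csource ex_pres b))"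
    | "ex_ceq a (alpha_post (mtarget ex_pres (csource ex_pres a)))"
      "ex_ceq b (alpha_post (mtarget ex_pres (csource ex_pres b)))"
    using ceq_CId_or_alpha[OF w(1)] ceq_CId_or_alpha[OF w(2)] e meq_imp_mtag_eq
    by (metis ex_mor.distinct(1) option.inject)
  then show ?thesis
  proof cases
    case 1
    then show ?thesis using ceq.ceq_id[OF s] ceq.ceq_trans ceq.ceq_sym by metis
  next
    case 2
    then show ?thesis using ex_meq_parallel[OF s] ceq.ceq_trans ceq.ceq_sym by metis
  qed
qed

section \<open>The example\<close>

definition ctag :: "ex_Mor \<Rightarrow> ex_mor option" where
  "ctag u = mtag (mrep u)"

lemma ex_Mor_cases:
  assumes "u \<in> Mor ex_two_cat"
  obtains f where "mwf ex_pres f" "u = mclass ex_pres f" "src ex_two_cat u = msource ex_pres f"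
    "tgt ex_two_cat u = mtarget ex_pres f" "ctag u = mtag f"
proof -
  obtain f where f: "mwf ex_pres f" "u = mclass ex_pres f"
    using assms by (auto simp: ex_two_cat_def presented_def)
  moreover have "ctag u = mtag f"
    using meq_imp_mtag_eq[OF meq_mrep[OF wf_presentation_ex_pres f(1)]] f by (simp add: ctag_def)
  ultimately show thesis
    using that by (simp add: ex_two_cat_def presented_src presented_tgt wf_presentation_ex_pres)
qed

lemma mclass_Mor:
  assumes "mwf ex_pres f"
  shows "mclass ex_pres f \<in> Mor ex_two_cat" "src ex_two_cat (mclass ex_pres f) = msource ex_pres f"
    "tgt ex_two_cat (mclass ex_pres f) = mtarget ex_pres f" "ctag (mclass ex_pres f) = mtag f"
  using assms meq_imp_mtag_eq[OF meq_mrep[OF wf_presentation_ex_pres assms]]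
  by (auto simp: ctag_def ex_two_cat_def presented_carriers presented_src presented_tgt
    wf_presentation_ex_pres)

lemma ex_Mor_eqI:
  assumes "u \<in> Mor ex_two_cat" "v \<in> Mor ex_two_cat" "src ex_two_cat u = src ex_two_cat v" "tgt ex_two_cat u = tgt ex_two_cat v" "ctag u = ctag v"
  shows "u = v"
  using assms(3-5)
  by (rule_tac ex_Mor_cases[OF assms(1)], rule_tac ex_Mor_cases[OF assms(2)])
    (auto intro!: mclass_eqI wf_presentation_ex_pres simp: ex_meq_iff)

lemma admissible_Mor: "u \<in> Mor ex_two_cat \<Longrightarrow> admissible (src ex_two_cat u) (tgt ex_two_cat u) (ctag u)"
  by (erule ex_Mor_cases) (simp add: admissible_mwf)

lemma admissible_ex_Mor:
  assumes "admissible x y t"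
  obtains u where "u \<in> Mor ex_two_cat" "src ex_two_cat u = x" "tgt ex_two_cat u = y" "ctag u = t"
  using that mclass_Mor[of "canon x y t"] mwf_canon[OF assms] by auto

lemma ctag_comp:
  assumes "u \<in> Mor ex_two_cat" "v \<in> Mor ex_two_cat" "src ex_two_cat v = tgt ex_two_cat u"
  shows "ctag (comp ex_two_cat v u) = (if ctag u = None then ctag v else ctag u)"
proof -
  obtain f g where f: "mwf ex_pres f" "u = mclass ex_pres f" "tgt ex_two_cat u = mtarget ex_pres f" "ctag u = mtag f"
    and g: "mwf ex_pres g" "v = mclass ex_pres g" "src ex_two_cat v = msource ex_pres g" "ctag v = mtag g"
    using assms ex_Mor_cases by metis
  then have "comp ex_two_cat v u = mclass ex_pres (MComp g f)"
    using assms(3) by (simp add: ex_two_cat_def presented_comp wf_presentation_ex_pres)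
  then show ?thesis using mclass_Mor(4)[of "MComp g f"] f g assms(3) by simp
qed

lemma ex_Obj [simp]: "Obj ex_two_cat = UNIV"
  by (simp add: ex_two_cat_def presented_def)

lemma ctag_one [simp]: "ctag (one ex_two_cat x) = None"
  using mclass_Mor(4)[of "MId x"] by (simp add: ex_two_cat_def presented_def)

lemma ex_gen_sel [simp]:
  "ex_gen m \<in> Mor ex_two_cat" "src ex_two_cat (ex_gen m) = ex_src m" "tgt ex_two_cat (ex_gen m) = ex_tgt m"
  "ctag (ex_gen m) = (if m = mor_f \<or> m = mor_g then Some m else None)"
  using mclass_Mor[of "MGen m"] by simp_all

lemma ex_Cel_cases:
  assumes "c \<in> Cel ex_two_cat"
  obtains a where "cwf ex_pres a" "c = cclass ex_pres a" "vsrc ex_two_cat c = mclass ex_pres (csource ex_pres a)"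
    "vtgt ex_two_cat c = mclass ex_pres (ctarget ex_pres a)"
  using assms
  by (auto simp: ex_two_cat_def presented_carriers presented_vsrc presented_vtgt wf_presentation_ex_pres)

text \<open>The direction matters: there is no 2-cell from tag g back to tag f.\<close>

lemma ex_Cel_boundary:
  assumes "c \<in> Cel ex_two_cat"
  shows "vsrc ex_two_cat c = vtgt ex_two_cat c \<or> ctag (vsrc ex_two_cat c) = Some mor_f \<and> ctag (vtgt ex_two_cat c) = Some mor_g"
  using assms
proof (rule ex_Cel_cases)
  fix a assume a: "cwf ex_pres a" "vsrc ex_two_cat c = mclass ex_pres (csource ex_pres a)"
    "vtgt ex_two_cat c = mclass ex_pres (ctarget ex_pres a)"
  then show ?thesis
    using ceq_CId_or_alpha[OF a(1)] ex_cwf_boundary[OF a(1)]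
    by (auto simp: mclass_Mor mclass_eqI[OF wf_presentation_ex_pres])
qed

lemma ex_alpha:
  obtains c where "c \<in> Cel ex_two_cat" "vsrc ex_two_cat c = ex_gen mor_f" "vtgt ex_two_cat c = ex_gen mor_g"
  by (rule that[of "cclass ex_pres (CGen cel_alpha)"])
    (auto simp: ex_two_cat_def presented_carriers presented_vsrc presented_vtgt wf_presentation_ex_pres)

lemma category_cospan: "category cospan_cat"
  by unfold_locales (auto simp: cospan_cat_def)

interpretation ex: thin_target cospan ex_two_cat
proof -
  have "two_category cospan"
    unfolding cospan_def by (rule two_category_locally_discrete[OF category_cospan])
  moreover have "two_category ex_two_cat"
    unfolding ex_two_cat_def by (rule two_category_presented[OF wf_presentation_ex_pres])
  moreover have "c = d"
    if "c \<in> Cel ex_two_cat" "d \<in> Cel ex_two_cat" "vsrc ex_two_cat c = vsrc ex_two_cat d" "vtgt ex_two_cat c = vtgt ex_two_cat d" for c d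
    using that(1)
  proof (rule ex_Cel_cases)
    fix a assume a: "cwf ex_pres a" "c = cclass ex_pres a"
      "vsrc ex_two_cat c = mclass ex_pres (csource ex_pres a)" "vtgt ex_two_cat c = mclass ex_pres (ctarget ex_pres a)"
    from that(2) show ?thesis
    proof (rule ex_Cel_cases)
      fix b assume b: "cwf ex_pres b" "d = cclass ex_pres b"
        "vsrc ex_two_cat d = mclass ex_pres (csource ex_pres b)" "vtgt ex_two_cat d = mclass ex_pres (ctarget ex_pres b)"
      have "ex_ceq a b"
        using a b that ex_cwf_boundary[OF a(1)]
        by (intro ceq_if_parallel) (simp_all add: mclass_eq_iff[OF wf_presentation_ex_pres])
      then show ?thesis using a b cclass_eqI[OF wf_presentation_ex_pres] by simp
    qed
  qed
  ultimately show "thin_target cospan ex_two_cat"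
    by (simp add: thin_target_def thin_target_axioms_def)
qed

section \<open>The cospan diagram and its cone\<close>

lemma cospan_sel [simp]:
  "Obj cospan = UNIV" "Mor cospan = {u. fst u = snd u \<or> snd u = Mid}" "Cel cospan = Mor cospan"
  "src cospan = fst" "tgt cospan = snd" "vsrc cospan = (\<lambda>u. u)" "vtgt cospan = (\<lambda>u. u)"
  "one cospan = (\<lambda>i. (i, i))" "comp cospan = (\<lambda>v u. (fst u, snd v))"
  by (auto simp: cospan_def locally_discrete_def cospan_cat_def)

lemma ex_diagram_mor_sel:
  assumes "u \<in> Mor cospan"
  shows "ex_diagram_mor u \<in> Mor ex_two_cat \<and> src ex_two_cat (ex_diagram_mor u) = ex_diagram_ob (fst u) \<and>
    tgt ex_two_cat (ex_diagram_mor u) = ex_diagram_ob (snd u) \<and> ctag (ex_diagram_mor u) = None"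
  using assms by (cases u; cases "fst u"; cases "snd u") (auto simp: ex_diagram_mor_def)

lemma ex_diagram_sel [simp]:
  "fob ex_diagram = ex_diagram_ob" "u \<in> Mor cospan \<Longrightarrow> fmor ex_diagram u = ex_diagram_mor u"
  by (simp_all add: ex_diagram_def)

lemma is_two_functor_ex_diagram: "is_two_functor cospan ex_two_cat ex_diagram"
proof (rule ex.is_two_functorI)
  note M = ex_diagram_mor_sel
  have one: "ex_diagram_mor (i, i) = one ex_two_cat (ex_diagram_ob i)" for i
    by (cases i) (simp_all add: ex_diagram_mor_def)
  have comp: "ex_diagram_mor (fst u, snd v) = comp ex_two_cat (ex_diagram_mor v) (ex_diagram_mor u)"
    if u: "u \<in> Mor cospan" and v: "v \<in> Mor cospan" and e: "fst v = snd u" for u v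
  proof -
    have "(fst u, snd v) \<in> Mor cospan" using u v e by auto
    then show ?thesis
      using M[of "(fst u, snd v)"] M[OF u] M[OF v] e
      by (intro ex_Mor_eqI) (simp_all del: cospan_sel(2) add: ctag_comp)
  qed
  show "is_functor (und_cat cospan) (und_cat ex_two_cat) (fob ex_diagram) (fmor ex_diagram)"
    unfolding is_functor_def
  proof (intro conjI ballI impI)
    fix u v
    assume "u \<in> Ar (und_cat cospan)" "v \<in> Ar (und_cat cospan)"
      "Dom (und_cat cospan) v = Cod (und_cat cospan) u"
    then have uv: "u \<in> Mor cospan" "v \<in> Mor cospan" "fst v = snd u" by (simp_all add: und_cat_def)
    then have "(fst u, snd v) \<in> Mor cospan" by auto
    then show "fmor ex_diagram (Cmp (und_cat cospan) v u) =
        Cmp (und_cat ex_two_cat) (fmor ex_diagram v) (fmor ex_diagram u)"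
      using comp[OF uv] uv by (simp add: und_cat_def del: cospan_sel(2))
  next
    fix u assume "u \<in> Ar (und_cat cospan)"
    then have u: "u \<in> Mor cospan" by (simp add: und_cat_def)
    then show "fmor ex_diagram u \<in> Ar (und_cat ex_two_cat)"
      "Dom (und_cat ex_two_cat) (fmor ex_diagram u) = fob ex_diagram (Dom (und_cat cospan) u)"
      "Cod (und_cat ex_two_cat) (fmor ex_diagram u) = fob ex_diagram (Cod (und_cat cospan) u)"
      using M[OF u] by (simp_all add: und_cat_def del: cospan_sel(2))
  qed (simp_all add: ex.J.und ex.A.und, simp_all add: und_cat_def one)
next
  fix u assume u: "u \<in> Cel cospan"
  then have "u \<in> Mor cospan" by simp
  then show "fcel ex_diagram u \<in> Cel ex_two_cat \<and> vsrc ex_two_cat (fcel ex_diagram u) = fmor ex_diagram (vsrc cospan u) \<and>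
      vtgt ex_two_cat (fcel ex_diagram u) = fmor ex_diagram (vtgt cospan u)"
    using ex_diagram_mor_sel[of u] u by (simp add: ex_diagram_def)
qed (simp_all add: ex_diagram_def)

text \<open>Tag \<open>None\<close> is the point: precomposing a component with \<open>u\<close>
  then yields a morphism with the tag of \<open>u\<close>.\<close>

lemma ex_cone_cmp_sel:
  "ex_cone_cmp i \<in> Mor ex_two_cat \<and> src ex_two_cat (ex_cone_cmp i) = obL \<and> tgt ex_two_cat (ex_cone_cmp i) = ex_diagram_ob i
    \<and> ctag (ex_cone_cmp i) = None"
  by (cases i) (auto simp: ctag_comp)

lemma is_two_cone_ex_cone: "is_two_cone cospan ex_two_cat ex_diagram obL ex_cone"
proof -
  have "is_two_nat cospan ex_two_cat ex_cone"
  proof (rule ex.is_two_natI)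
    fix u assume u: "u \<in> Mor cospan"
    show "comp ex_two_cat (fmor (ntgt ex_cone) u) (ncmp ex_cone (src cospan u)) =
        comp ex_two_cat (ncmp ex_cone (tgt cospan u)) (fmor (nsrc ex_cone) u)"
      using u ex_diagram_mor_sel[OF u] ex_cone_cmp_sel ex.A.src_one[of obL] ex.A.tgt_one[of obL]
      \<comment> \<open>At the arrow \<open>(Rgt, Mid)\<close> this is the defining relation, here
        hidden in the comparison of invariants.\<close>
      by (intro ex_Mor_eqI) (simp_all add: ex_cone_def ctag_comp)
  qed (use ex_cone_cmp_sel in \<open>auto simp: ex_cone_def ex.is_two_functor_diag is_two_functor_ex_diagram\<close>)
  then show ?thesis by (simp add: is_two_cone_def ex_cone_def)
qed

section \<open>Lifting cones and modifications along the cone\<close>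

lemma ex_cone_sel [simp]:
  "nsrc ex_cone = diag_ob cospan ex_two_cat obL" "ntgt ex_cone = ex_diagram" "ncmp ex_cone = ex_cone_cmp"
  by (simp_all add: ex_cone_def)

lemma is_two_nat_ex_cone: "is_two_nat cospan ex_two_cat ex_cone"
  using is_two_cone_ex_cone by (simp add: is_two_cone_def)

text \<open>The functor of the 2-limit condition on objects; \<open>ex_pull_cel\<close> is its
  action on 2-cells.\<close>

abbreviation ex_pull :: "ex_Mor \<Rightarrow> _" where
  "ex_pull u \<equiv> nat_comp cospan ex_two_cat ex_cone (diag_mor cospan ex_two_cat u)"

lemma is_two_nat_ex_pull:
  "\<lbrakk>u \<in> Mor ex_two_cat; tgt ex_two_cat u = obL\<rbrakk> \<Longrightarrow> is_two_nat cospan ex_two_cat (ex_pull u)"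
  by (rule ex.is_two_nat_comp) (simp_all add: is_two_nat_ex_cone ex.is_two_nat_diag)

lemma ex_pull_ncmp:
  assumes "u \<in> Mor ex_two_cat" "tgt ex_two_cat u = obL"
  shows "ncmp (ex_pull u) i \<in> Mor ex_two_cat \<and> src ex_two_cat (ncmp (ex_pull u) i) = src ex_two_cat u \<and>
    tgt ex_two_cat (ncmp (ex_pull u) i) = ex_diagram_ob i \<and> ctag (ncmp (ex_pull u) i) = ctag u"
  using assms ex_cone_cmp_sel[of i] by (simp add: ctag_comp)

lemma ex_cone_factor:
  assumes \<mu>: "is_two_nat cospan ex_two_cat \<mu>" "nsrc \<mu> = diag_ob cospan ex_two_cat x" "ntgt \<mu> = ex_diagram"
  obtains u where "u \<in> Mor ex_two_cat" "src ex_two_cat u = x" "tgt ex_two_cat u = obL" "\<mu> = ex_pull u"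
proof -
  have cmp: "ncmp \<mu> i \<in> Mor ex_two_cat" "src ex_two_cat (ncmp \<mu> i) = x" "tgt ex_two_cat (ncmp \<mu> i) = ex_diagram_ob i" for i
    using ex.two_natD(3,4,5)[OF \<mu>(1), of i] \<mu>(2,3) by simp_all
  \<comment> \<open>Naturality along the arrow from \<open>i\<close> to \<open>Mid\<close> forces a
    common tag, because the legs of the diagram have tag \<open>None\<close>.\<close>
  have tag: "ctag (ncmp \<mu> i) = ctag (ncmp \<mu> Mid)" for i
  proof -
    have u: "(i, Mid) \<in> Mor cospan" by simp
    have "comp ex_two_cat (ex_diagram_mor (i, Mid)) (ncmp \<mu> i) = comp ex_two_cat (ncmp \<mu> Mid) (one ex_two_cat x)"
      using ex.two_natD(6)[OF \<mu>(1) u] \<mu>(2,3) by simp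
    then have "ctag (comp ex_two_cat (ex_diagram_mor (i, Mid)) (ncmp \<mu> i)) = ctag (comp ex_two_cat (ncmp \<mu> Mid) (one ex_two_cat x))"
      by simp
    then show ?thesis
      using cmp[of i] cmp[of Mid] ex_diagram_mor_sel[OF u] ex.A.src_one[of x] ex.A.tgt_one[of x]
      by (simp add: ctag_comp split: if_splits)
  qed
  \<comment> \<open>Having morphisms to both B and C leaves only L and X as the vertex, and the
    common tag then names the arrow into L.\<close>
  have "admissible x obB (ctag (ncmp \<mu> Mid))" "admissible x obC (ctag (ncmp \<mu> Mid))"
    using admissible_Mor[OF cmp(1)[of Lft]] admissible_Mor[OF cmp(1)[of Rgt]] cmp
      tag[of Lft] tag[of Rgt] by simp_all
  then have "admissible x obL (ctag (ncmp \<mu> Mid))"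
    by (auto simp: admissible_def split: option.splits)
  then obtain u where u: "u \<in> Mor ex_two_cat" "src ex_two_cat u = x" "tgt ex_two_cat u = obL" "ctag u = ctag (ncmp \<mu> Mid)"
    by (rule admissible_ex_Mor)
  have "\<mu> = ex_pull u"
    using \<mu> u is_two_nat_ex_pull[OF u(1,3)] ex_pull_ncmp[OF u(1,3)] cmp tag[folded u(4)]
    by (intro ex.two_nat_eqI ex_Mor_eqI) (simp_all del: ex.nat_comp_sel(3))
  with u that show thesis by blast
qed

text \<open>A single component, here at \<open>Mid\<close>, already recovers the source and tag of
  the morphism.\<close>

lemma ex_pull_inj:
  assumes "u \<in> Mor ex_two_cat" "tgt ex_two_cat u = obL" "v \<in> Mor ex_two_cat" "tgt ex_two_cat v = obL" "src ex_two_cat u = src ex_two_cat v"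
    and "ex_pull u = ex_pull v"
  shows "u = v"
  using assms ex_pull_ncmp[of u Mid] ex_pull_ncmp[of v Mid] by (intro ex_Mor_eqI) auto

text \<open>A modification between pulled-back cones can only be an identity or lie over \<open>\<alpha>\<close>, since the
  components of the cone preserve tags.\<close>

lemma ex_cell_lift:
  assumes u: "u \<in> Mor ex_two_cat" "tgt ex_two_cat u = obL" and v: "v \<in> Mor ex_two_cat" "tgt ex_two_cat v = obL"
    and s: "src ex_two_cat u = src ex_two_cat v"
    and m: "is_modification cospan ex_two_cat \<phi>" "msrc \<phi> = ex_pull u" "mtgt \<phi> = ex_pull v"
  obtains c where "c \<in> Cel ex_two_cat" "vsrc ex_two_cat c = u" "vtgt ex_two_cat c = v"
proof -
  note U = ex_pull_ncmp[OF u, of Mid] and V = ex_pull_ncmp[OF v, of Mid]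
  have c: "mcmp \<phi> Mid \<in> Cel ex_two_cat" "vsrc ex_two_cat (mcmp \<phi> Mid) = ncmp (ex_pull u) Mid"
    "vtgt ex_two_cat (mcmp \<phi> Mid) = ncmp (ex_pull v) Mid"
    using m unfolding ex.is_modification_iff by auto
  \<comment> \<open>The component at \<open>Mid\<close> alone decides which case holds, since it has
    the tags of \<open>u\<close> and \<open>v\<close> on its boundary.\<close>
  then consider "ctag u = ctag v" | "ctag u = Some mor_f" "ctag v = Some mor_g"
    using ex_Cel_boundary[OF c(1)] U V by metis
  then show thesis
  proof cases
    case 1
    then have "u = v" using u v s by (intro ex_Mor_eqI) auto
    then show thesis using that[of "vone ex_two_cat u"] u by simp
  next
    case 2
    then have "src ex_two_cat u = obX" using admissible_Mor[OF u(1)] by (simp add: admissible_def)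
    then have "u = ex_gen mor_f" and "v = ex_gen mor_g"
      using u v s 2 by (intro ex_Mor_eqI; simp)+
    moreover obtain c where "c \<in> Cel ex_two_cat" "vsrc ex_two_cat c = ex_gen mor_f" "vtgt ex_two_cat c = ex_gen mor_g"
      by (rule ex_alpha)
    ultimately show thesis using that by simp
  qed
qed

abbreviation ex_pull_cel :: "ex_Cel \<Rightarrow> _" where
  "ex_pull_cel c \<equiv> mod_hcomp cospan ex_two_cat (mod_one cospan ex_two_cat ex_cone) (diag_cel cospan ex_two_cat c)"

lemma is_modification_ex_pull_cel:
  assumes "c \<in> Cel ex_two_cat" "tgt ex_two_cat (vsrc ex_two_cat c) = obL"
  shows "is_modification cospan ex_two_cat (ex_pull_cel c)"
  using assms
  by (intro ex.is_modification_hcomp ex.is_modification_one ex.is_modification_diag is_two_nat_ex_cone)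
    simp_all

section \<open>The universal property and the failure of 2-terminality\<close>

lemma is_two_limit_ex_cone: "is_two_limit cospan ex_two_cat ex_diagram obL ex_cone"
proof -
  have "is_iso_functor (hom_cat ex_two_cat x obL) (hom_cat (fun_two_cat cospan ex_two_cat) (diag_ob cospan ex_two_cat x) ex_diagram)
      ex_pull ex_pull_cel" (is "is_iso_functor ?H ?K _ _") for x
  proof (rule is_functor_bij_imp_iso)
    have H: "u \<in> Ob ?H \<longleftrightarrow> u \<in> Mor ex_two_cat \<and> src ex_two_cat u = x \<and> tgt ex_two_cat u = obL"
      "c \<in> Ar ?H \<longleftrightarrow> c \<in> Cel ex_two_cat \<and> src ex_two_cat (vsrc ex_two_cat c) = x \<and> tgt ex_two_cat (vsrc ex_two_cat c) = obL"
      "Dom ?H = vsrc ex_two_cat" "Cod ?H = vtgt ex_two_cat" "Idn ?H = vone ex_two_cat" "Cmp ?H = vcomp ex_two_cat" for u c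
      by (simp_all add: hom_cat_def)
    have K: "\<mu> \<in> Ob ?K \<longleftrightarrow> is_two_nat cospan ex_two_cat \<mu> \<and> nsrc \<mu> = diag_ob cospan ex_two_cat x \<and> ntgt \<mu> = ex_diagram"
      "\<phi> \<in> Ar ?K \<longleftrightarrow> is_modification cospan ex_two_cat \<phi> \<and> nsrc (msrc \<phi>) = diag_ob cospan ex_two_cat x
        \<and> ntgt (msrc \<phi>) = ex_diagram"
      "Dom ?K = msrc" "Cod ?K = mtgt" "Idn ?K = mod_one cospan ex_two_cat" "Cmp ?K = mod_vcomp cospan ex_two_cat" for \<mu> \<phi>
      by (simp_all add: hom_cat_def fun_two_cat_def)
    show "is_functor ?H ?K ex_pull ex_pull_cel"
      unfolding is_functor_def H K
    proof (intro conjI ballI impI)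
      show "category ?H" by (rule ex.A.category_hom_cat)
      show "category ?K" by (rule ex.category_hom_fun_two_cat)
    next
      fix u assume "u \<in> Ob ?H"
      then have u: "u \<in> Mor ex_two_cat" "src ex_two_cat u = x" "tgt ex_two_cat u = obL" by (simp_all add: H)
      show "ex_pull_cel (vone ex_two_cat u) = mod_one cospan ex_two_cat (ex_pull u)"
        using u by (intro ex.modification_eqI is_modification_ex_pull_cel ex.is_modification_one
          is_two_nat_ex_pull) simp_all
    next
      fix c d assume "c \<in> Ar ?H" "d \<in> Ar ?H" "vsrc ex_two_cat d = vtgt ex_two_cat c"
      then show "ex_pull_cel (vcomp ex_two_cat d c) = mod_vcomp cospan ex_two_cat (ex_pull_cel d) (ex_pull_cel c)"
        by (intro ex.modification_eqI is_modification_ex_pull_cel ex.is_modification_vcomp)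
          (simp_all add: H)
    qed (auto simp: H is_two_nat_ex_pull is_modification_ex_pull_cel)
    show "bij_betw ex_pull (Ob ?H) (Ob ?K)"
    proof (rule bij_betw_imageI)
      show "inj_on ex_pull (Ob ?H)" by (rule inj_onI, rule ex_pull_inj) (simp_all add: H)
      have "\<mu> \<in> ex_pull ` Ob ?H" if "\<mu> \<in> Ob ?K" for \<mu>
      proof -
        from that have "is_two_nat cospan ex_two_cat \<mu>" "nsrc \<mu> = diag_ob cospan ex_two_cat x" "ntgt \<mu> = ex_diagram"
          by (simp_all add: K)
        then show ?thesis by (rule ex_cone_factor) (simp add: H)
      qed
      then show "ex_pull ` Ob ?H = Ob ?K" by (auto simp: H K is_two_nat_ex_pull)
    qed
    show "bij_betw ex_pull_cel (Ar ?H) (Ar ?K)"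
    proof (rule bij_betw_imageI)
      show "inj_on ex_pull_cel (Ar ?H)"
      proof (rule inj_onI)
        fix c d assume c: "c \<in> Ar ?H" and d: "d \<in> Ar ?H" and e: "ex_pull_cel c = ex_pull_cel d"
        \<comment> \<open>By thinness, injectivity on cells follows from injectivity on their
          boundary morphisms.\<close>
        have "ex_pull (vsrc ex_two_cat c) = ex_pull (vsrc ex_two_cat d)" "ex_pull (vtgt ex_two_cat c) = ex_pull (vtgt ex_two_cat d)"
          using arg_cong[OF e, of msrc] arg_cong[OF e, of mtgt] by simp_all
        then show "c = d"
          using c d by (intro ex.thin ex_pull_inj)
            (simp_all add: H ex.A.globular_src ex.A.globular_tgt)
      qed
      have "\<phi> \<in> ex_pull_cel ` Ar ?H" if "\<phi> \<in> Ar ?K" for \<phi>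
      proof -
        have p: "is_modification cospan ex_two_cat \<phi>" "nsrc (msrc \<phi>) = diag_ob cospan ex_two_cat x"
          "ntgt (msrc \<phi>) = ex_diagram" using that by (simp_all add: K)
        note D = ex.modificationD[OF p(1)]
        obtain u where u: "u \<in> Mor ex_two_cat" "src ex_two_cat u = x" "tgt ex_two_cat u = obL" "msrc \<phi> = ex_pull u"
          by (rule ex_cone_factor[OF D(1) p(2,3)])
        obtain v where v: "v \<in> Mor ex_two_cat" "src ex_two_cat v = x" "tgt ex_two_cat v = obL" "mtgt \<phi> = ex_pull v"
          by (rule ex_cone_factor[OF D(2) D(3)[unfolded p(2)] D(4)[unfolded p(3)]])
        obtain c where c: "c \<in> Cel ex_two_cat" "vsrc ex_two_cat c = u" "vtgt ex_two_cat c = v"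
          using ex_cell_lift[OF u(1,3) v(1,3) _ p(1) u(4) v(4)] u v by auto
        \<comment> \<open>Lifting the boundary is enough, because parallel modifications
          coincide.\<close>
        have "\<phi> = ex_pull_cel c"
          using c u v p by (intro ex.modification_eqI is_modification_ex_pull_cel) simp_all
        then show ?thesis using c u by (auto simp: H)
      qed
      then show "ex_pull_cel ` Ar ?H = Ar ?K"
        by (auto simp: H K is_modification_ex_pull_cel)
    qed
  qed
  then show ?thesis using is_two_cone_ex_cone by (simp add: is_two_limit_def)
qed

lemma not_two_terminal_ex_cone: "\<not> two_terminal (lax_slice cospan ex_two_cat ex_diagram) (obL, ex_cone)"
proof
  assume t: "two_terminal (lax_slice cospan ex_two_cat ex_diagram) (obL, ex_cone)"
  let ?f = "ex_gen mor_f" and ?g = "ex_gen mor_g"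
  \<comment> \<open>The cone must be the target \<lambda>g: the modification of a lax morphism
    points towards the cone of its source object, so \<lambda> * \<alpha> is usable here, whereas
    from \<lambda>f there is no modification out of \<lambda>g.\<close>
  let ?z = "(obX, ex_pull ?g)"
  have z: "is_two_cone cospan ex_two_cat ex_diagram (fst ?z) (snd ?z)"
    using is_two_nat_ex_pull[of ?g] by (simp add: is_two_cone_def)
  obtain c where c: "c \<in> Cel ex_two_cat" "vsrc ex_two_cat c = ?f" "vtgt ex_two_cat c = ?g" by (rule ex_alpha)
  define p where "p = \<lparr>lsrc = ?z, ltgt = (obL, ex_cone), lmor = ?f, lmod = ex_pull_cel c\<rparr>"
  define q where "q = \<lparr>lsrc = ?z, ltgt = (obL, ex_cone), lmor = ?g, lmod = mod_one cospan ex_two_cat (ex_pull ?g)\<rparr>"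
  have "is_lax_mor cospan ex_two_cat ex_diagram p"
    using z is_two_cone_ex_cone c is_modification_ex_pull_cel[of c] by (simp add: is_lax_mor_def p_def)
  moreover have "is_lax_mor cospan ex_two_cat ex_diagram q"
    using z is_two_cone_ex_cone ex.is_modification_one[OF is_two_nat_ex_pull[of ?g]]
    by (simp add: is_lax_mor_def q_def)
  moreover have "isomorphic_cat (hom_cat (lax_slice cospan ex_two_cat ex_diagram) ?z (obL, ex_cone)) terminal_cat"
    using t z by (auto simp: two_terminal_def lax_slice_def)
  ultimately have "p = q"
    by (elim isomorphic_terminal_cat_Ob_unique) (auto simp: hom_cat_def lax_slice_def p_def q_def)
  then have "ctag ?f = ctag ?g" by (simp add: p_def q_def)
  then show False by simp
qed

theorem mainTheorem5:
  shows "is_two_limit cospan ex_two_cat ex_diagram obL ex_cone \<and>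
    two_category (lax_slice cospan ex_two_cat ex_diagram) \<and>
    (obL, ex_cone) \<in> Obj (lax_slice cospan ex_two_cat ex_diagram) \<and>
    \<not> two_terminal (lax_slice cospan ex_two_cat ex_diagram) (obL, ex_cone)"
  using is_two_limit_ex_cone ex.two_category_lax_slice is_two_cone_ex_cone not_two_terminal_ex_cone
  by (simp add: lax_slice_def)

end
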